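(* For every $\varepsilon>0$ (with $\varepsilon<\pi/2$, so that the sector below is nonempty) there exist constants $C_\varepsilon,\kappa_\varepsilon>0$ such that for all $z\in\Sigma_{\frac\pi2-\varepsilon}$ and $y,\rho>0$: if $c<1$, $$|D_yp_{B^d}(z,y,\rho)|\le C_\varepsilon|z|^{-1}\Big(\frac y{|z|^{1/2}}\wedge1\Big)^{-c}\Big(\frac\rho{|z|^{1/2}}\wedge1\Big)\exp\Big(-\frac{|y-\rho|^2}{\kappa_\varepsilon|z|}\Big),$$ and if $c>-1$, $$|D_yp_{B^n}(z,y,\rho)|\le C_\varepsilon|z|^{-1}\Big(\frac y{|z|^{1/2}}\wedge1\Big)\Big(\frac\rho{|z|^{1/2}}\wedge1\Big)^{c}\exp\Big(-\frac{|y-\rho|^2}{\kappa_\varepsilon|z|}\Big).$$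
   Context: $c\in\mathbb{R}$ is fixed; $\Sigma_\phi=\{z\in\mathbb{C}\setminus\{0\}:|\arg z|<\phi\}$; $a\wedge b=\min\{a,b\}$; $I_\nu$ is the modified Bessel function of the first kind. For $\mathrm{Re}\,z>0$ and $y,\rho>0$, $$p_{B^n}(z,y,\rho)=\frac1{2z}\rho^c(y\rho)^{\frac{1-c}2}\exp\Big\{-\frac{y^2+\rho^2}{4z}\Big\}I_{\frac{c-1}2}\Big(\frac{y\rho}{2z}\Big)\quad(c>-1),$$ $$p_{B^d}(z,y,\rho)=\frac1{2z}\rho^c(y\rho)^{\frac{1-c}2}\exp\Big\{-\frac{y^2+\rho^2}{4z}\Big\}I_{\frac{1-c}2}\Big(\frac{y\rho}{2z}\Big)\quad(c<1).$$ The constants may depend on $c$. *)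

theory Defs
  imports "HOL-Analysis.Analysis"
begin

definition sector :: "real \<Rightarrow> complex set" where
  "sector \<phi> = {z. z \<noteq> 0 \<and> \<bar>Arg z\<bar> < \<phi>}"

text \<open>
  Modified Bessel function of the first kind, of real order. The power is the principal one
  (cut along the negative real axis); using \<^const>\<open>rGamma\<close>, the reciprocal Gamma function, covers
  all orders, including those where the Gamma function has a pole.
\<close>
definition bessel_I :: "real \<Rightarrow> complex \<Rightarrow> complex" where
  "bessel_I \<nu> w = (w / 2) powr (of_real \<nu>) *
     (\<Sum>m. ((w / 2) ^ 2) ^ m * rGamma (of_real \<nu> + of_nat m + 1) / fact m)"

text \<open>
  The two kernels are meant for \<open>c > -1\<close> and \<open>c < 1\<close> respectively, with \<open>Re z > 0\<close> and
  \<open>y, \<rho> > 0\<close>. The powers of \<open>\<rho>\<close> and \<open>y * \<rho>\<close> are real powers of positive numbers.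
\<close>
definition p_Bn :: "real \<Rightarrow> complex \<Rightarrow> real \<Rightarrow> real \<Rightarrow> complex" where
  "p_Bn c z y \<rho> = 1 / (2 * z) * of_real (\<rho> powr c * (y * \<rho>) powr ((1 - c) / 2))
     * exp (- of_real (y\<^sup>2 + \<rho>\<^sup>2) / (4 * z))
     * bessel_I ((c - 1) / 2) (of_real (y * \<rho>) / (2 * z))"

definition p_Bd :: "real \<Rightarrow> complex \<Rightarrow> real \<Rightarrow> real \<Rightarrow> complex" where
  "p_Bd c z y \<rho> = 1 / (2 * z) * of_real (\<rho> powr c * (y * \<rho>) powr ((1 - c) / 2))
     * exp (- of_real (y\<^sup>2 + \<rho>\<^sup>2) / (4 * z))
     * bessel_I ((1 - c) / 2) (of_real (y * \<rho>) / (2 * z))"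

end

theory Submission
  imports Defs
begin

text \<open>
  Write \<open>I\<^sub>\<nu>(w) = (w/2)\<^sup>\<nu> F\<^sub>\<nu>(w)\<close> with \<open>F\<^sub>\<nu>(w) = bessel_series \<nu> ((w/2)^2)\<close> entire.
  For \<open>\<nu> > 1/2\<close> Poisson's integral writes \<open>F\<^sub>\<nu>(w)\<close> as
  a multiple of the integral of \<open>(1-t^2) powr (\<nu>-1/2) * exp (w*t)\<close> over \<open>[-1,1]\<close>, and
  \<open>(w/2) F\<^bsub>\<nu>+1\<^esub>(w)\<close> is its derivative. Hence, on a sector inside the right half plane,
  \<open>F\<^sub>\<nu>(w)\<close> is of size \<open>(1+|w|) powr (-\<nu>-1/2) * exp (Re w)\<close>, and the difference
  \<open>F\<^sub>\<nu>(w) - (w/2) F\<^bsub>\<nu>+1\<^esub>(w)\<close> gains one more factor \<open>(1+|w|)^-1\<close> because it carries the extra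
  weight \<open>1-t\<close>. The recurrence \<open>F\<^sub>\<nu> = (\<nu>+1) F\<^bsub>\<nu>+1\<^esub> + (w/2)^2 F\<^bsub>\<nu>+2\<^esub>\<close> carries both bounds to all real
  \<open>\<nu>\<close>. In the derivative of the kernels, \<open>y F\<^sub>\<nu> - \<rho> (w/2) F\<^bsub>\<nu>+1\<^esub>\<close> is split as
  \<open>(y-\<rho>) F\<^sub>\<nu> + \<rho> (F\<^sub>\<nu> - (w/2) F\<^bsub>\<nu>+1\<^esub>)\<close>, and \<open>exp (Re w)\<close> combines with the Gaussian factors to
  \<open>exp (- Re (1/z) (y-\<rho>)^2 / 4)\<close>. With \<open>Y\<close>, \<open>R\<close> denoting \<open>y\<close>, \<open>\<rho>\<close> divided by \<open>sqrt |z|\<close>, the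
  quantities \<open>max(Y,1)^2\<close>, \<open>max(R,1)^2\<close> and \<open>1+YR/2\<close> agree up to powers of \<open>1+|Y-R|\<close>, which
  half of the Gaussian absorbs.
\<close>

section \<open>The entire part of the Bessel function\<close>

text \<open>In the variable \<open>u\<close>, which stands for \<open>(w/2)^2\<close>, this is
  entire, and differentiation only raises the order.\<close>

definition bessel_series :: "real \<Rightarrow> complex \<Rightarrow> complex" where
  "bessel_series \<nu> u = (\<Sum>m. rGamma (of_real \<nu> + of_nat m + 1) / fact m * u ^ m)"

text \<open>Ratio test: by \<open>rGamma z = z * rGamma (z + 1)\<close> the reciprocal Gamma factor
  does not grow once \<open>1 \<le> cmod z\<close>, and the factorial contributes at most
  \<open>cmod u / r \<le> 1/2\<close>.\<close>

lemma bessel_series_summable: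
  "summable (\<lambda>m. rGamma (of_real \<nu> + of_nat m + 1) / fact m * u ^ m :: complex)"
proof -
  obtain N :: nat where N: "real N \<ge> \<bar>\<nu>\<bar> + 2 * cmod u"
    using real_arch_simple by blast
  show ?thesis
  proof (rule summable_ratio_test[where c = "1/2" and N = N])
    fix m assume m: "N \<le> m"
    define z :: complex where "z = of_real \<nu> + of_nat m + 1"
    define r where "r = real m + 1"
    have rm: "r \<ge> 2 * cmod u" "r > 0" using N m unfolding r_def by linarith+
    have zr: "z = of_real (\<nu> + real m + 1)" unfolding z_def by simp
    have z1: "1 \<le> cmod z" using N m norm_ge_zero[of u] unfolding zr norm_of_real by linarith
    have "rGamma z = z * rGamma (z + 1)" by (simp add: rGamma_plus1)
    then have "cmod (rGamma z) = cmod z * cmod (rGamma (z + 1))" by (simp add: norm_mult)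
    then have g: "cmod (rGamma (z + 1)) \<le> cmod (rGamma z)"
      using mult_right_mono[OF z1, of "cmod (rGamma (z+1))"] by simp
    have e: "of_real \<nu> + of_nat (Suc m) + 1 = z + 1" by (simp add: z_def)
    have "cmod (rGamma (z + 1) / fact (Suc m) * u ^ Suc m)
        = cmod (rGamma (z + 1)) / fact m * cmod u ^ m * (cmod u / r)"
    proof -
      have "cmod (fact (Suc m)) = r * fact m"
        by (simp add: r_def norm_mult flip: of_nat_Suc)
      then show ?thesis by (simp add: norm_mult norm_divide norm_power mult_ac)
    qed
    also have "\<dots> \<le> cmod (rGamma z) / fact m * cmod u ^ m * (1/2)"
      by (intro mult_mono divide_right_mono g) (use rm in \<open>auto simp: divide_simps\<close>)
    also have "\<dots> = 1/2 * cmod (rGamma z / fact m * u ^ m)"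
      by (simp add: norm_mult norm_divide norm_power)
    finally show "cmod (rGamma (of_real \<nu> + of_nat (Suc m) + 1) / fact (Suc m) * u ^ Suc m)
      \<le> 1/2 * cmod (rGamma (of_real \<nu> + of_nat m + 1) / fact m * u ^ m)"
      unfolding e by (simp add: z_def)
  qed simp
qed

lemma bessel_series_sums:
  "(\<lambda>m. rGamma (of_real \<nu> + of_nat m + 1) / fact m * u ^ m) sums bessel_series \<nu> u"
  unfolding bessel_series_def by (rule summable_sums[OF bessel_series_summable])

lemma bessel_I_eq: "bessel_I \<nu> w = (w / 2) powr of_real \<nu> * bessel_series \<nu> ((w / 2) ^ 2)"
  unfolding bessel_I_def bessel_series_def by (simp add: mult.commute)

text \<open>In the termwise derivative \<open>m + 1\<close> cancels against the factorial, which
  leaves the coefficients of the next order.\<close>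

lemma DERIV_bessel_series:
  "(bessel_series \<nu> has_field_derivative bessel_series (\<nu> + 1) u) (at u)"
proof -
  have "rGamma (of_real \<nu> + of_nat (Suc m) + 1) = (rGamma (of_real (\<nu> + 1) + of_nat m + 1) :: complex)" for m
    by (rule arg_cong[where f = rGamma]) simp
  then have "diffs (\<lambda>m. rGamma (of_real \<nu> + of_nat m + 1) / fact m)
      = (\<lambda>m. rGamma (of_real (\<nu> + 1) + of_nat m + 1) / fact m :: complex)"
    by (auto simp: diffs_def fun_eq_iff divide_simps simp del: of_nat_Suc)
  then show ?thesis
    using termdiffs_strong_converges_everywhere[OF bessel_series_summable, of \<nu> u]
    unfolding bessel_series_def[abs_def] by simp
qed

text \<open>Coefficientwise this is \<open>rGamma z = z * rGamma (z + 1)\<close> with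
  \<open>z = \<nu> + 1 + m\<close>: the part \<open>\<nu> + 1\<close> of \<open>z\<close> gives the
  first series, the part \<open>m\<close> the second one after an index shift.\<close>

lemma bessel_series_rec:
  "bessel_series \<nu> u = of_real (\<nu> + 1) * bessel_series (\<nu> + 1) u + u * bessel_series (\<nu> + 2) u"
proof -
  define f where "f = (\<lambda>m. of_nat m * (rGamma (of_real (\<nu> + 1) + of_nat m + 1) / fact m * u ^ m) :: complex)"
  have "(\<lambda>m. u * (rGamma (of_real (\<nu> + 2) + of_nat m + 1) / fact m * u ^ m)) sums (u * bessel_series (\<nu> + 2) u)"
    by (intro sums_mult bessel_series_sums)
  moreover have "rGamma (of_real (\<nu> + 2) + of_nat m + 1) = (rGamma (of_real (\<nu> + 1) + of_nat (Suc m) + 1) :: complex)" for m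
    by (rule arg_cong[where f = rGamma]) simp
  then have "(\<lambda>m. u * (rGamma (of_real (\<nu> + 2) + of_nat m + 1) / fact m * u ^ m)) = (\<lambda>m. f (Suc m))"
    by (auto simp: f_def fun_eq_iff divide_simps simp del: of_nat_Suc)
  \<comment> \<open>The factor \<open>m\<close> makes \<open>f 0\<close> vanish, so the shift by one
    index loses nothing.\<close>
  ultimately have "f sums (u * bessel_series (\<nu> + 2) u + f 0)" by (intro sums_Suc) simp
  then have f: "f sums (u * bessel_series (\<nu> + 2) u)" by (simp add: f_def)
  have "(\<lambda>m. of_real (\<nu> + 1) * (rGamma (of_real (\<nu> + 1) + of_nat m + 1) / fact m * u ^ m) + f m)
      sums (of_real (\<nu> + 1) * bessel_series (\<nu> + 1) u + u * bessel_series (\<nu> + 2) u)"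
    by (intro sums_add sums_mult bessel_series_sums f)
  also have "(\<lambda>m. of_real (\<nu> + 1) * (rGamma (of_real (\<nu> + 1) + of_nat m + 1) / fact m * u ^ m) + f m)
      = (\<lambda>m. rGamma (of_real \<nu> + of_nat m + 1) / fact m * u ^ m)"
  proof
    fix m
    define z :: complex where "z = of_real \<nu> + of_nat m + 1"
    have "rGamma z = z * rGamma (z + 1)" by (simp add: rGamma_plus1)
    moreover have "of_real (\<nu> + 1) + of_nat m + 1 = z + 1" by (simp add: z_def)
    ultimately show "of_real (\<nu> + 1) * (rGamma (of_real (\<nu> + 1) + of_nat m + 1) / fact m * u ^ m) + f m
        = rGamma (of_real \<nu> + of_nat m + 1) / fact m * u ^ m"
      unfolding f_def z_def[symmetric] by (simp add: z_def field_simps)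
  qed
  finally show ?thesis using bessel_series_sums sums_unique2 by blast
qed

section \<open>Moments of the Poisson weight\<close>

text \<open>The exponential series is integrated term by term, which the Weierstrass M-test permits:
  on the compact interval \<open>g\<close> is bounded by \<open>B\<close> and
  \<open>\<bar>t\<bar>\<close> by \<open>r\<close>.\<close>

lemma exp_weighted_integral_sums:
  fixes g :: "real \<Rightarrow> real" and w :: complex
  assumes "continuous_on {a..b} g"
  shows "(\<lambda>n. w ^ n / fact n * of_real (integral {a..b} (\<lambda>t. g t * t ^ n)))
    sums integral {a..b} (\<lambda>t. of_real (g t) * exp (w * of_real t))"
proof -
  define f where "f = (\<lambda>n t. of_real (g t) * (w * of_real t) ^ n /\<^sub>R fact n :: complex)"
  obtain B where B: "\<And>t. t \<in> {a..b} \<Longrightarrow> \<bar>g t\<bar> \<le> B"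
    using compact_imp_bounded[OF compact_continuous_image[OF assms compact_Icc]]
    unfolding bounded_iff by (metis imageI real_norm_def)
  define r where "r = max \<bar>a\<bar> \<bar>b\<bar>"
  have ul: "uniform_limit {a..b} (\<lambda>n t. \<Sum>i<n. f i t) (\<lambda>t. \<Sum>i. f i t) sequentially"
  proof (rule Weierstrass_m_test)
    show "summable (\<lambda>n. B * ((cmod w * r) ^ n /\<^sub>R fact n))"
      by (intro summable_mult summable_exp_generic)
    fix n t assume t: "t \<in> {a..b}"
    have "(cmod w * \<bar>t\<bar>) ^ n \<le> (cmod w * r) ^ n"
      using t by (intro power_mono mult_left_mono) (auto simp: r_def)
    then show "cmod (f n t) \<le> B * ((cmod w * r) ^ n /\<^sub>R fact n)"
      using B[OF t] unfolding f_def
      by (auto simp: norm_mult norm_power divide_inverse mult.assoc intro!: mult_mono)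
  qed
  have sf: "(\<Sum>i. f i t) = of_real (g t) * exp (w * of_real t)" for t
    unfolding f_def using sums_mult[OF exp_converges[of "w * of_real t"], of "of_real (g t)"]
    by (simp add: sums_iff)
  have cf: "continuous_on {a..b} (f i)" for i
    unfolding f_def by (intro continuous_intros assms)
  obtain I J where IJ: "\<And>n. ((\<lambda>t. \<Sum>i<n. f i t) has_integral I n) {a..b}"
      "((\<lambda>t. \<Sum>i. f i t) has_integral J) {a..b}" "(I \<longlongrightarrow> J) sequentially"
    by (rule uniform_limit_integral[OF ul]) (auto intro!: continuous_intros cf)
  have fi: "integral {a..b} (f i) = w ^ i / fact i * of_real (integral {a..b} (\<lambda>t. g t * t ^ i))" for i
  proof -
    have "integral {a..b} (f i) = integral {a..b} (\<lambda>t. w ^ i / fact i * of_real (g t * t ^ i))"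
      by (intro integral_cong) (simp add: f_def power_mult_distrib scaleR_conv_of_real divide_inverse)
    also have "\<dots> = w ^ i / fact i * integral {a..b} (\<lambda>t. of_real (g t * t ^ i))"
      by simp
    also have "integral {a..b} (\<lambda>t. of_real (g t * t ^ i) :: complex) = of_real (integral {a..b} (\<lambda>t. g t * t ^ i))"
      by (rule integral_unique, rule has_integral_of_real, rule integrable_integral)
        (intro integrable_continuous_interval continuous_intros assms)
    finally show ?thesis .
  qed
  have "I = (\<lambda>n. \<Sum>i<n. integral {a..b} (f i))"
  proof
    fix n
    show "I n = (\<Sum>i<n. integral {a..b} (f i))"
    using has_integral_unique[OF IJ(1)[of n]]
    by (metis cf finite_lessThan has_integral_sum integrable_continuous_interval integrable_integral)
  qed
  with IJ(2,3) show ?thesis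
    unfolding sums_def by (simp add: sf fi has_integral_iff)
qed

text \<open>Here \<open>even\<close> refers to the weight, an even function of \<open>t\<close>;
  \<open>n\<close> ranges over all naturals.\<close>

definition even_weight_moment :: "real \<Rightarrow> nat \<Rightarrow> real" where
  "even_weight_moment a n = integral {-1..1} (\<lambda>t. (1 - t\<^sup>2) powr a * t ^ n)"

lemma continuous_on_weight:
  "a > 0 \<Longrightarrow> continuous_on {-1..1::real} (\<lambda>t. (1 - t\<^sup>2) powr a)"
  by (intro continuous_on_powr' continuous_intros) (auto simp: abs_square_le_1)

lemma integrable_weight_moment:
  "a > 0 \<Longrightarrow> (\<lambda>t. (1 - t\<^sup>2) powr a * t ^ n) integrable_on {-1..1::real}"
  by (intro integrable_continuous_interval continuous_intros continuous_on_weight)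

text \<open>The integrand is the derivative of \<open>(1 - t^2) powr (a + 1) * t ^ n\<close>, which
  vanishes at both ends. For \<open>n = 0\<close> the truncated exponent \<open>n - 1\<close> is
  harmless, as its term carries the factor \<open>n\<close>.\<close>

lemma weight_integral_by_parts:
  assumes a: "a > 0"
  shows "((\<lambda>t::real. real n * ((1 - t\<^sup>2) powr a * t ^ (n - 1))
    - (2 * a + 2 + real n) * ((1 - t\<^sup>2) powr a * t ^ (n + 1))) has_integral 0) {-1..1}"
proof -
  have "((\<lambda>t::real. real n * ((1 - t\<^sup>2) powr a * t ^ (n - 1))
    - (2 * a + 2 + real n) * ((1 - t\<^sup>2) powr a * t ^ (n + 1))) has_integral
     ((1 - 1\<^sup>2) powr (a + 1) * 1 ^ n - (1 - (-1)\<^sup>2) powr (a + 1) * (-1) ^ n)) {-1..1}"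
  \<comment> \<open>The interior version asks for the derivative only where \<open>1 - t^2\<close>
    is positive; at the endpoints continuity suffices.\<close>
  proof (rule fundamental_theorem_of_calculus_interior)
    show "continuous_on {-1..1::real} (\<lambda>t. (1 - t\<^sup>2) powr (a + 1) * t ^ n)"
      using a by (intro continuous_intros continuous_on_weight) auto
    fix t :: real assume "t \<in> {-1<..<1}"
    then have t: "1 - t\<^sup>2 > 0" using abs_square_less_1[of t] by auto
    have p: "(1 - t\<^sup>2) powr (a + 1) = (1 - t\<^sup>2) powr a * (1 - t\<^sup>2)"
      using t by (simp add: powr_add)
    have "((\<lambda>t. (1 - t\<^sup>2) powr (a + 1) * t ^ n) has_real_derivative
       (a + 1) * (1 - t\<^sup>2) powr a * (- 2 * t) * t ^ n + (1 - t\<^sup>2) powr (a + 1) * (real n * t ^ (n - 1))) (at t)"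
      using t by (auto intro!: derivative_eq_intros simp: powr_diff)
    moreover have "(a + 1) * (1 - t\<^sup>2) powr a * (- 2 * t) * t ^ n + (1 - t\<^sup>2) powr (a + 1) * (real n * t ^ (n - 1))
      = real n * ((1 - t\<^sup>2) powr a * t ^ (n - 1))
        - (2 * a + 2 + real n) * ((1 - t\<^sup>2) powr a * t ^ (n + 1))"
      unfolding p by (cases n) (simp_all add: algebra_simps power2_eq_square)
    ultimately show "((\<lambda>t. (1 - t\<^sup>2) powr (a + 1) * t ^ n) has_vector_derivative
        real n * ((1 - t\<^sup>2) powr a * t ^ (n - 1))
        - (2 * a + 2 + real n) * ((1 - t\<^sup>2) powr a * t ^ (n + 1))) (at t)"
      by (simp add: has_real_derivative_iff_has_vector_derivative)
  qed simp
  then show ?thesis by simp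
qed

lemma even_weight_moment_rec:
  assumes a: "a > 0"
  shows "real n * even_weight_moment a (n - 1) = (2 * a + 2 + real n) * even_weight_moment a (n + 1)"
proof -
  have "((\<lambda>t::real. real n * ((1 - t\<^sup>2) powr a * t ^ (n - 1))
    - (2 * a + 2 + real n) * ((1 - t\<^sup>2) powr a * t ^ (n + 1))) has_integral
      (real n * even_weight_moment a (n - 1) - (2 * a + 2 + real n) * even_weight_moment a (n + 1))) {-1..1}"
    unfolding even_weight_moment_def
    by (intro has_integral_diff has_integral_mult_right integrable_integral integrable_weight_moment a)
  from has_integral_unique[OF this weight_integral_by_parts[OF a]] show ?thesis by simp
qed

text \<open>At \<open>n = 0\<close> the left side of the moment recurrence vanishes, hence so does
  the first moment; the other odd moments follow in steps of two.\<close>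

lemma even_weight_moment_odd:
  assumes a: "a > 0"
  shows "even_weight_moment a (2 * m + 1) = 0"
proof (induction m)
  case 0
  then show ?case using even_weight_moment_rec[OF a, of 0] a by simp
next
  case (Suc m)
  then show ?case using even_weight_moment_rec[OF a, of "2 * m + 2"] a by simp
qed

text \<open>A continuous nonnegative weight with integral zero would vanish at \<open>t = 0\<close>,
  where it equals 1.\<close>

lemma even_weight_moment_0_pos:
  assumes a: "a > 0"
  shows "even_weight_moment a 0 > 0"
proof -
  have ge: "(1 - t\<^sup>2) powr a \<ge> 0" for t :: real by simp
  have "integral {-1..1} (\<lambda>t::real. (1 - t\<^sup>2) powr a) \<noteq> 0"
  proof
    assume "integral {-1..1} (\<lambda>t::real. (1 - t\<^sup>2) powr a) = 0"
    then have "((\<lambda>t::real. (1 - t\<^sup>2) powr a) has_integral 0) (cbox (-1) 1)"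
      using integrable_weight_moment[OF a, of 0] by (simp add: has_integral_iff)
    then have "(1 - 0\<^sup>2) powr a = (0::real)"
      by (rule has_integral_0_cbox_imp_0[rotated 2]) (use continuous_on_weight[OF a] in auto)
    then show False by simp
  qed
  moreover have "integral {-1..1} (\<lambda>t::real. (1 - t\<^sup>2) powr a) \<ge> 0"
    by (rule Henstock_Kurzweil_Integration.integral_nonneg) (use integrable_weight_moment[OF a, of 0] in auto)
  ultimately show ?thesis by (simp add: even_weight_moment_def)
qed

text \<open>Both sides obey the same first-order recurrence in \<open>m\<close>, and
  \<open>\<kappa>\<close> is fixed by \<open>m = 0\<close>. This matches the moments with the
  coefficients of \<open>bessel_series\<close> of order \<open>a + 1/2\<close>.\<close>

lemma even_weight_moment_even:
  assumes a: "a > 0"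
  defines "\<kappa> \<equiv> of_real (even_weight_moment a 0) / rGamma (of_real (a + 3 / 2)) :: complex"
  shows "of_real (even_weight_moment a (2 * m)) / fact (2 * m)
    = \<kappa> * rGamma (of_real (a + 1 / 2) + of_nat m + 1) / (fact m * 4 ^ m)"
proof (induction m)
  case 0
  have "rGamma (of_real (a + 3 / 2) :: complex) \<noteq> 0"
    using a by (subst rGamma_eq_zero_iff) (auto dest!: nonpos_Ints_nonpos simp only: of_real_in_nonpos_Ints_iff)
  moreover have "of_real (a + 1 / 2) + of_nat 0 + 1 = (of_real (a + 3 / 2) :: complex)"
    by (simp add: complex_eq_iff)
  ultimately show ?case unfolding \<kappa>_def by (simp only:) simp
next
  case (Suc m)
  define M where "M = even_weight_moment a"
  define z :: complex where "z = of_real (a + 1 / 2) + of_nat m + 1"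
  have zr: "z = of_real (a + real m + 3 / 2)" by (simp add: z_def complex_eq_iff)
  then have z0: "z \<noteq> 0" using a by (simp add: add_pos_nonneg complex_eq_iff)
  \<comment> \<open>The moment recurrence at \<open>n = 2 * m + 1\<close>; its right-hand
    coefficient is \<open>2 * z\<close>.\<close>
  have "(2 * real m + 1) * M (2 * m) = (2 * a + 3 + 2 * real m) * M (2 * m + 2)"
    using even_weight_moment_rec[OF a, of "2 * m + 1"] by (simp add: M_def add_ac)
  then have "complex_of_real ((2 * real m + 1) * M (2 * m)) = 2 * z * of_real (M (2 * m + 2))"
    unfolding zr by (simp add: algebra_simps)
  then have rec: "(2 * of_nat m + 1) * of_real (M (2 * m)) = 2 * z * of_real (M (2 * m + 2))"
    by simp
  have f: "fact (2 * Suc m) = (2 * (of_nat m + 1) * (2 * of_nat m + 1) * fact (2 * m) :: complex)"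
    by (simp add: algebra_simps)
  have n0: "(2 * of_nat m + 1 :: complex) \<noteq> 0" "(of_nat m + 1 :: complex) \<noteq> 0"
    by (simp_all add: complex_eq_iff)
  have quot: "y / (2 * q * p * F) = x / F / (4 * q * z)"
    if "p * x = 2 * z * y" "p \<noteq> 0" "q \<noteq> 0" "F \<noteq> 0" for x y p q F :: complex
    using that z0 by (simp add: field_simps)
  have "complex_of_real (M (2 * Suc m)) / fact (2 * Suc m)
      = of_real (M (2 * m + 2)) / (2 * (of_nat m + 1) * (2 * of_nat m + 1) * fact (2 * m))"
    unfolding f by simp
  also have "\<dots> = of_real (M (2 * m)) / fact (2 * m) / (4 * (of_nat m + 1) * z)"
    by (rule quot) (use rec n0 in auto)
  also have "of_real (M (2 * m)) / fact (2 * m) = \<kappa> * rGamma z / (fact m * 4 ^ m)"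
    using Suc.IH by (simp only: M_def z_def)
  also have "\<dots> / (4 * (of_nat m + 1) * z) = \<kappa> * (rGamma z / z) / (fact (Suc m) * 4 ^ Suc m)"
    by (simp add: mult_ac add_ac)
  also have "rGamma z / z = rGamma (z + 1)"
    using z0 rGamma_plus1[of z] by (simp add: field_simps)
  finally show ?case by (simp add: M_def z_def add_ac)
qed

section \<open>Poisson's integral\<close>

context
  fixes a :: real and \<kappa> :: complex
  assumes a: "a > 0"
  defines "\<kappa> \<equiv> of_real (even_weight_moment a 0) / rGamma (of_real (a + 3 / 2))"
begin

text \<open>In the exponential series under the integral the odd moments drop out, and the even ones
  turn it into a power series in \<open>(w/2)^2\<close>.\<close>

lemma bessel_series_poisson:
  "integral {-1..1} (\<lambda>t. of_real ((1 - t\<^sup>2) powr a) * exp (w * of_real t))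
    = \<kappa> * bessel_series (a + 1 / 2) ((w / 2)\<^sup>2)"
proof -
  define f where "f = (\<lambda>n. w ^ n / fact n * of_real (even_weight_moment a n))"
  have fz: "f n = 0" if "n \<notin> range ((*) 2)" for n
  proof -
    have "odd n" using that by (metis evenE rangeI)
    then show ?thesis by (auto simp: f_def even_weight_moment_odd[OF a, simplified] elim!: oddE)
  qed
  have sm: "strict_mono ((*) (2 :: nat))" by (auto simp: strict_mono_def)
  have "f (2 * m) = \<kappa> * (rGamma (of_real (a + 1 / 2) + of_nat m + 1) / fact m * ((w / 2)\<^sup>2) ^ m)" for m
  proof -
    have "f (2 * m) = w ^ (2 * m) * (of_real (even_weight_moment a (2 * m)) / fact (2 * m))"
      by (simp add: f_def)
    also have "\<dots> = \<kappa> * (rGamma (of_real (a + 1 / 2) + of_nat m + 1) / fact m * (w ^ (2 * m) / 4 ^ m))"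
      unfolding even_weight_moment_even[OF a] \<kappa>_def by (simp add: mult_ac)
    also have "w ^ (2 * m) / 4 ^ m = ((w / 2)\<^sup>2) ^ m"
      by (simp add: power_mult power_divide)
    finally show ?thesis .
  qed
  then have "(\<lambda>m. f (2 * m)) sums (\<kappa> * bessel_series (a + 1 / 2) ((w / 2)\<^sup>2))"
    by (simp only:) (intro sums_mult bessel_series_sums)
  then have "f sums (\<kappa> * bessel_series (a + 1 / 2) ((w / 2)\<^sup>2))"
    using sums_mono_reindex[OF sm, of f] fz by blast
  moreover have "f sums integral {-1..1} (\<lambda>t. of_real ((1 - t\<^sup>2) powr a) * exp (w * of_real t))"
    using exp_weighted_integral_sums[OF continuous_on_weight[OF a], of w]
    by (simp add: f_def even_weight_moment_def)
  ultimately show ?thesis using sums_unique2 by blast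
qed

text \<open>This is the \<open>w\<close>-derivative of the previous identity, but it is read off the
  moments directly: the extra factor \<open>t\<close> shifts them by one, so only odd
  \<open>n\<close> survive.\<close>

lemma bessel_series_poisson_deriv:
  "integral {-1..1} (\<lambda>t. of_real ((1 - t\<^sup>2) powr a * t) * exp (w * of_real t))
    = \<kappa> * (w / 2 * bessel_series (a + 3 / 2) ((w / 2)\<^sup>2))"
proof -
  define f where "f = (\<lambda>n. w ^ n / fact n * of_real (even_weight_moment a (n + 1)))"
  have fz: "f n = 0" if "n \<notin> range (\<lambda>m. 2 * m + 1)" for n
  proof -
    have "even n" using that by (metis (mono_tags, lifting) oddE rangeI)
    then show ?thesis by (auto simp: f_def even_weight_moment_odd[OF a, simplified] elim!: evenE)
  qed
  have sm: "strict_mono (\<lambda>m :: nat. 2 * m + 1)" by (auto simp: strict_mono_def)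
  have "f (2 * m + 1) = \<kappa> * (w / 2 * (rGamma (of_real (a + 3 / 2) + of_nat m + 1) / fact m * ((w / 2)\<^sup>2) ^ m))" for m
  proof -
    \<comment> \<open>Multiplying and dividing by \<open>2 * m + 2\<close> completes the factorial
      to \<open>fact (2 * Suc m)\<close>, so that the even moment formula applies at
      \<open>Suc m\<close>.\<close>
    have "f (2 * m + 1) = w * w ^ (2 * m) * (2 * of_nat (Suc m)) *
       (of_real (even_weight_moment a (2 * Suc m)) / fact (2 * Suc m))"
      unfolding f_def by (simp add: divide_simps del: of_nat_Suc) (simp add: algebra_simps)
    also have "\<dots> = \<kappa> * (w / 2 * (rGamma (of_real (a + 1 / 2) + of_nat (Suc m) + 1) / fact m
        * (w ^ (2 * m) / 4 ^ m)))"
      unfolding even_weight_moment_even[OF a] \<kappa>_def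
      by (simp add: divide_simps del: of_nat_Suc)
    also have "of_real (a + 1 / 2) + of_nat (Suc m) + 1 = (of_real (a + 3 / 2) + of_nat m + 1 :: complex)"
      by (simp add: complex_eq_iff)
    also have "w ^ (2 * m) / 4 ^ m = ((w / 2)\<^sup>2) ^ m"
      by (simp add: power_mult power_divide)
    finally show ?thesis .
  qed
  then have "(\<lambda>m. f (2 * m + 1)) sums (\<kappa> * (w / 2 * bessel_series (a + 3 / 2) ((w / 2)\<^sup>2)))"
    by (simp only:) (intro sums_mult bessel_series_sums)
  then have "f sums (\<kappa> * (w / 2 * bessel_series (a + 3 / 2) ((w / 2)\<^sup>2)))"
    using sums_mono_reindex[OF sm, of f] fz by blast
  moreover have "f sums integral {-1..1} (\<lambda>t. of_real ((1 - t\<^sup>2) powr a * t) * exp (w * of_real t))"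
  proof -
    have "continuous_on {-1..1::real} (\<lambda>t. (1 - t\<^sup>2) powr a * t)"
      by (intro continuous_intros continuous_on_weight a)
    from exp_weighted_integral_sums[OF this, of w] show ?thesis
      by (simp add: f_def even_weight_moment_def mult.assoc)
  qed
  ultimately show ?thesis using sums_unique2 by blast
qed

text \<open>Allows bounds on the Poisson integrals to be divided by
  \<open>cmod \<kappa>\<close>.\<close>

lemma poisson_const_nonzero: "\<kappa> \<noteq> 0"
proof -
  have "rGamma (of_real (a + 3 / 2) :: complex) \<noteq> 0"
    using a by (subst rGamma_eq_zero_iff) (auto dest!: nonpos_Ints_nonpos simp only: of_real_in_nonpos_Ints_iff)
  then show ?thesis using even_weight_moment_0_pos[OF a] by (simp add: \<kappa>_def)
qed

end

section \<open>Decay of exponentially weighted integrals\<close>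

text \<open>With \<open>v = b * u / (a + 1)\<close>, the inequality \<open>ln v \<le> v - 1\<close>
  gives \<open>v powr a \<le> exp (a * v)\<close>, and \<open>a * v \<le> b * u\<close>. Dividing by
  \<open>a + 1\<close> instead of \<open>a\<close> covers \<open>a = 0\<close>.\<close>

lemma powr_le_exp:
  fixes a b u :: real
  assumes "a \<ge> 0" "b > 0" "u \<ge> 0"
  shows "u powr a \<le> ((a + 1) / b) powr a * exp (b * u)"
proof -
  define v where "v = b * u / (a + 1)"
  have v: "v \<ge> 0" using assms by (simp add: v_def)
  have "u powr a = ((a + 1) / b * v) powr a" using assms by (simp add: v_def)
  also have "\<dots> = ((a + 1) / b) powr a * v powr a" by (rule powr_mult)
  also have "v powr a \<le> exp (a * v)"
  proof (cases "v = 0")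
    case False
    then have "a * ln v \<le> a * v" using v assms ln_le_minus_one[of v] by (intro mult_left_mono) auto
    then show ?thesis using False by (simp add: powr_def)
  qed simp
  also have "a * v \<le> b * u"
    using assms by (simp add: v_def divide_simps algebra_simps)
  finally show "u powr a \<le> ((a + 1) / b) powr a * exp (b * u)"
    by (simp add: mult_left_mono)
qed

text \<open>The weight \<open>(1-t) powr b\<close> is effectively evaluated at distance \<open>1/(1 + Re w)\<close> from \<open>t = 1\<close>.\<close>

lemma exp_weighted_integral_bound:
  fixes g :: "real \<Rightarrow> real" and w :: complex and B b :: real
  assumes b: "b \<ge> 0" and B: "B \<ge> 0" and g: "continuous_on {-1..1} g"
    "\<And>t. t \<in> {-1..1} \<Longrightarrow> \<bar>g t\<bar> \<le> B * (1 - t) powr b"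
    and w: "Re w \<ge> 0"
  shows "cmod (integral {-1..1} (\<lambda>t. of_real (g t) * exp (w * of_real t)))
      \<le> 2 * exp 2 * (2 * (b + 1)) powr b * B * (1 + Re w) powr (- b - 1) * exp (Re w)"
proof -
  define K where "K = (2 * (b + 1)) powr b"
  have K: "K > 0" "\<And>u. u \<ge> 0 \<Longrightarrow> u powr b \<le> K * exp (1 / 2 * u)"
    using b powr_le_exp[OF b, of "1 / 2"] by (auto simp: K_def mult.commute)
  define x where "x = 1 + Re w"
  have x: "x \<ge> 1" using w by (simp add: x_def)
  \<comment> \<open>The majorant left after half of the exponential decay away from
    \<open>t = 1\<close> has been spent on the weight.\<close>
  define h where "h = (\<lambda>t. exp 2 * K * B * x powr (- b) * exp (Re w) * exp (x * (t - 1) / 2))"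
  have ptw: "cmod (of_real (g t) * exp (w * of_real t)) \<le> h t" if t: "t \<in> {-1..1}" for t
  proof -
    define u where "u = x * (1 - t)"
    have u: "u \<ge> 0" using t x by (simp add: u_def)
    have "B * (1 - t) powr b = B * x powr (- b) * u powr b"
      using x t by (simp add: u_def powr_mult powr_minus)
    also have "\<dots> \<le> B * x powr (- b) * (K * exp (1 / 2 * u))"
      by (intro mult_left_mono K u) (simp add: B)
    finally have 1: "\<bar>g t\<bar> \<le> B * x powr (- b) * (K * exp (1 / 2 * u))" using order.trans[OF g(2)[OF t]] by (simp add: mult.assoc)
    have "cmod (of_real (g t) * exp (w * of_real t)) = \<bar>g t\<bar> * exp (Re w * t)"
      by (simp add: norm_mult)
    also have "\<dots> \<le> B * x powr (- b) * (K * exp (1 / 2 * u)) * exp (Re w * t)"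
      by (intro mult_right_mono 1) simp
    also have "\<dots> = K * B * x powr (- b) * exp (u / 2 + Re w * t)"
      by (simp add: exp_add)
    \<comment> \<open>The right side exceeds the left by \<open>2 - (1 - t)\<close>, which is
      nonnegative on the interval; this is the source of \<open>exp 2\<close>.\<close>
    also have "u / 2 + Re w * t \<le> 2 + Re w + x * (t - 1) / 2"
      using t by (simp add: u_def x_def algebra_simps divide_simps)
    also have "K * B * x powr (- b) * exp (2 + Re w + x * (t - 1) / 2) = h t"
      by (simp add: h_def exp_add)
    finally show ?thesis using K B by (simp add: mult_left_mono)
  qed
  have hi: "(h has_integral
      (exp 2 * K * B * x powr (- b) * exp (Re w) * (2 / x * exp (x * (1 - 1) / 2) - 2 / x * exp (x * (-1 - 1) / 2)))) {-1..1}"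
    unfolding h_def
  proof (rule has_integral_mult_right, rule fundamental_theorem_of_calculus)
    fix t :: real
    have "((\<lambda>t. 2 / x * exp (x * (t - 1) / 2)) has_real_derivative exp (x * (t - 1) / 2)) (at t within {-1..1})"
      using x by (auto intro!: derivative_eq_intros)
    then show "((\<lambda>t. 2 / x * exp (x * (t - 1) / 2)) has_vector_derivative exp (x * (t - 1) / 2)) (at t within {-1..1})"
      by (simp add: has_real_derivative_iff_has_vector_derivative)
  qed simp
  have "cmod (integral {-1..1} (\<lambda>t. of_real (g t) * exp (w * of_real t))) \<le> integral {-1..1} h"
    by (rule integral_norm_bound_integral)
      (use hi ptw in \<open>auto simp: has_integral_iff intro!: integrable_continuous_interval continuous_intros g(1)\<close>)
  \<comment> \<open>Dropping the contribution of \<open>t = -1\<close> leaves \<open>2 / x\<close>,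
    the additional negative power of \<open>1 + Re w\<close>.\<close>
  also have "\<dots> \<le> exp 2 * K * B * x powr (- b) * exp (Re w) * (2 / x)"
    unfolding integral_unique[OF hi] using K x B by (intro mult_left_mono) auto
  also have "\<dots> = 2 * exp 2 * K * B * (1 + Re w) powr (- b - 1) * exp (Re w)"
    using x by (simp add: powr_diff flip: x_def)
  finally show ?thesis unfolding K_def .
qed

section \<open>Bounds in a sector\<close>

text \<open>For \<open>0 < \<sigma> \<le> 1\<close> the condition on \<open>w\<close> describes a
  closed sector around the positive axis. The two estimates are bundled because lowering the order
  needs the second one for the next higher order.\<close>

definition bessel_bound :: "real \<Rightarrow> real \<Rightarrow> real \<Rightarrow> bool" where
  "bessel_bound \<sigma> \<nu> C \<longleftrightarrow> C > 0 \<and> (\<forall>w. \<sigma> * cmod w \<le> Re w \<longrightarrow>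
     cmod (bessel_series \<nu> ((w / 2)\<^sup>2)) \<le> C * (1 + cmod w) powr (- \<nu> - 1 / 2) * exp (Re w) \<and>
     cmod (bessel_series \<nu> ((w / 2)\<^sup>2) - w / 2 * bessel_series (\<nu> + 1) ((w / 2)\<^sup>2))
       \<le> C * (1 + cmod w) powr (- \<nu> - 3 / 2) * exp (Re w))"

lemma bessel_boundD:
  assumes "bessel_bound \<sigma> \<nu> C" "\<sigma> * cmod w \<le> Re w"
  shows "cmod (bessel_series \<nu> ((w / 2)\<^sup>2)) \<le> C * (1 + cmod w) powr (- \<nu> - 1 / 2) * exp (Re w)"
    and "cmod (bessel_series \<nu> ((w / 2)\<^sup>2) - w / 2 * bessel_series (\<nu> + 1) ((w / 2)\<^sup>2))
       \<le> C * (1 + cmod w) powr (- \<nu> - 3 / 2) * exp (Re w)"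
  using assms unfolding bessel_bound_def by blast+

lemma bessel_bound_mono: "bessel_bound \<sigma> \<nu> C \<Longrightarrow> C \<le> C' \<Longrightarrow> bessel_bound \<sigma> \<nu> C'"
  unfolding bessel_bound_def by (fastforce intro: order.trans mult_right_mono)

text \<open>Both quantities are Poisson integrals with \<open>a = \<nu> - 1/2\<close>. The weight is
  at most \<open>B * (1 - t) powr a\<close>, and in the difference the factor \<open>1 - t\<close>
  raises that exponent by one.\<close>

lemma bessel_bound_large_order:
  assumes \<sigma>: "0 < \<sigma>" "\<sigma> \<le> 1" and \<nu>: "\<nu> > 1 / 2"
  shows "\<exists>C. bessel_bound \<sigma> \<nu> C"
proof -
  define a where "a = \<nu> - 1 / 2"
  have a: "a > 0" and \<nu>a: "\<nu> = a + 1 / 2" using \<nu> by (simp_all add: a_def)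
  have e: "- \<nu> - 1 / 2 = - a - 1" "- \<nu> - 3 / 2 = - a - 2" by (simp_all add: \<nu>a)
  define K1 where "K1 = 2 * exp 2 * (2 * (a + 1)) powr a"
  define K2 where "K2 = 2 * exp 2 * (2 * (a + 1 + 1)) powr (a + 1)"
  have K: "K1 > 0" "K2 > 0" using a by (auto simp: K1_def K2_def)
  define \<kappa> :: complex where "\<kappa> = of_real (even_weight_moment a 0) / rGamma (of_real (a + 3 / 2))"
  have \<kappa>: "cmod \<kappa> > 0" using poisson_const_nonzero[OF a] by (simp add: \<kappa>_def)
  define B where "B = (2::real) powr a"
  have B: "B > 0" by (simp add: B_def)
  have weight: "(1 - t\<^sup>2) powr a \<le> B * (1 - t) powr a" if "t \<in> {-1..1}" for t :: real
  proof -
    have "1 - t\<^sup>2 \<le> 2 * (1 - t)"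
      using that mult_right_mono[of "1 + t" 2 "1 - t"] by (simp add: algebra_simps power2_eq_square)
    moreover have "0 \<le> 1 - t\<^sup>2" using that by (simp add: abs_square_le_1 abs_le_iff)
    ultimately show ?thesis using a by (simp add: B_def powr_mono2 flip: powr_mult)
  qed
  define C1 where "C1 = K1 * B / cmod \<kappa> * \<sigma> powr (- a - 1)"
  define C2 where "C2 = K2 * B / cmod \<kappa> * \<sigma> powr (- a - 2)"
  have pos: "C1 > 0" "C2 > 0" using K B \<kappa> \<sigma> by (auto simp: C1_def C2_def)
  have "bessel_bound \<sigma> \<nu> (max C1 C2)"
    unfolding bessel_bound_def
  proof (intro conjI allI impI)
    show "max C1 C2 > 0" using pos by simp
    fix w assume w: "\<sigma> * cmod w \<le> Re w"
    have rw: "Re w \<ge> 0" using w \<sigma> by (meson mult_nonneg_nonneg norm_ge_zero order.trans less_imp_le)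
    define P where "P = 1 + cmod w"
    have P: "P \<ge> 1" by (simp add: P_def)
    \<comment> \<open>In the sector \<open>1 + Re w\<close> dominates a multiple of
      \<open>1 + cmod w\<close>; \<open>\<sigma> \<le> 1\<close> takes care of the summand
      1.\<close>
    have sP: "\<sigma> * P \<le> 1 + Re w" using w \<sigma> by (simp add: P_def algebra_simps)
    have pw: "(1 + Re w) powr (- e) \<le> \<sigma> powr (- e) * P powr (- e)" if "e > 0" for e
    proof -
      have "(1 + Re w) powr (- e) \<le> (\<sigma> * P) powr (- e)"
        using that \<sigma> P sP by (intro powr_mono2') auto
      then show ?thesis by (simp add: powr_mult)
    qed
    have 1: "cmod (integral {-1..1} (\<lambda>t. of_real ((1 - t\<^sup>2) powr a) * exp (w * of_real t)))
      \<le> K1 * B * (1 + Re w) powr (- a - 1) * exp (Re w)"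
      unfolding K1_def by (rule exp_weighted_integral_bound) (use weight a B rw in \<open>auto intro!: continuous_on_weight a\<close>)
    have "cmod \<kappa> * cmod (bessel_series \<nu> ((w / 2)\<^sup>2)) \<le> K1 * B * (1 + Re w) powr (- a - 1) * exp (Re w)"
      using 1 unfolding bessel_series_poisson[OF a] \<kappa>_def[symmetric] \<nu>a norm_mult .
    also have "\<dots> \<le> K1 * B * (\<sigma> powr (- a - 1) * P powr (- a - 1)) * exp (Re w)"
      using pw[of "a + 1"] a K(1) B by (intro mult_right_mono mult_left_mono) auto
    finally have "cmod (bessel_series \<nu> ((w / 2)\<^sup>2)) \<le> C1 * P powr (- a - 1) * exp (Re w)"
      using \<kappa> by (simp add: C1_def field_simps)
    also have "\<dots> \<le> max C1 C2 * P powr (- a - 1) * exp (Re w)"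
      by (intro mult_right_mono) auto
    finally show "cmod (bessel_series \<nu> ((w / 2)\<^sup>2)) \<le> max C1 C2 * (1 + cmod w) powr (- \<nu> - 1 / 2) * exp (Re w)"
      by (simp only: P_def e)
    have c: "continuous_on {-1..1} (\<lambda>t::real. (1 - t\<^sup>2) powr a * (1 - t))"
      by (intro continuous_intros continuous_on_weight a)
    have 2: "cmod (integral {-1..1} (\<lambda>t. of_real ((1 - t\<^sup>2) powr a * (1 - t)) * exp (w * of_real t)))
      \<le> K2 * B * (1 + Re w) powr (- (a + 1) - 1) * exp (Re w)"
      unfolding K2_def
    proof (rule exp_weighted_integral_bound[OF _ _ c _ rw])
      fix t :: real assume t: "t \<in> {-1..1}"
      have "(1 - t\<^sup>2) powr a * (1 - t) \<le> B * (1 - t) powr a * (1 - t)"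
        using t by (intro mult_right_mono weight) auto
      then show "\<bar>(1 - t\<^sup>2) powr a * (1 - t)\<bar> \<le> B * (1 - t) powr (a + 1)"
        using t by (cases "t = 1") (auto simp: powr_add)
    qed (use a B in auto)
    have i: "(\<lambda>t. of_real ((1 - t\<^sup>2) powr a) * exp (w * of_real t)) integrable_on {-1..1}"
            "(\<lambda>t. of_real ((1 - t\<^sup>2) powr a * t) * exp (w * of_real t)) integrable_on {-1..1}"
      by (intro integrable_continuous_interval continuous_intros continuous_on_weight a)+
    have "integral {-1..1} (\<lambda>t. of_real ((1 - t\<^sup>2) powr a * (1 - t)) * exp (w * of_real t))
       = integral {-1..1} (\<lambda>t. of_real ((1 - t\<^sup>2) powr a) * exp (w * of_real t)
           - of_real ((1 - t\<^sup>2) powr a * t) * exp (w * of_real t))"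
      by (rule integral_cong) (simp add: algebra_simps)
    also have "\<dots> = \<kappa> * (bessel_series \<nu> ((w / 2)\<^sup>2) - w / 2 * bessel_series (\<nu> + 1) ((w / 2)\<^sup>2))"
      unfolding integral_diff[OF i] bessel_series_poisson[OF a] bessel_series_poisson_deriv[OF a] \<kappa>_def[symmetric] \<nu>a
      by (simp add: algebra_simps)
    finally have diff: "integral {-1..1} (\<lambda>t. of_real ((1 - t\<^sup>2) powr a * (1 - t)) * exp (w * of_real t))
      = \<kappa> * (bessel_series \<nu> ((w / 2)\<^sup>2) - w / 2 * bessel_series (\<nu> + 1) ((w / 2)\<^sup>2))" .
    have e2: "- (a + 1) - 1 = - a - 2" by simp
    have "cmod \<kappa> * cmod (bessel_series \<nu> ((w / 2)\<^sup>2) - w / 2 * bessel_series (\<nu> + 1) ((w / 2)\<^sup>2))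
        \<le> K2 * B * (1 + Re w) powr (- a - 2) * exp (Re w)"
      using 2 unfolding diff norm_mult[of \<kappa>] e2 .
    also have "\<dots> \<le> K2 * B * (\<sigma> powr (- a - 2) * P powr (- a - 2)) * exp (Re w)"
      using pw[of "a + 2"] a K(2) B by (intro mult_right_mono mult_left_mono) auto
    finally have "cmod (bessel_series \<nu> ((w / 2)\<^sup>2) - w / 2 * bessel_series (\<nu> + 1) ((w / 2)\<^sup>2))
        \<le> C2 * P powr (- a - 2) * exp (Re w)"
      using \<kappa> by (simp add: C2_def field_simps)
    also have "\<dots> \<le> max C1 C2 * P powr (- a - 2) * exp (Re w)"
      by (intro mult_right_mono) auto
    finally show "cmod (bessel_series \<nu> ((w / 2)\<^sup>2) - w / 2 * bessel_series (\<nu> + 1) ((w / 2)\<^sup>2))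
        \<le> max C1 C2 * (1 + cmod w) powr (- \<nu> - 3 / 2) * exp (Re w)"
      by (simp only: P_def e)
  qed
  then show ?thesis by blast
qed

text \<open>In the recurrence every factor \<open>w/2\<close> costs one power of \<open>P\<close>,
  which the stronger decay at the higher orders makes up for.\<close>

lemma bessel_bound_lower_order:
  assumes 1: "bessel_bound \<sigma> (\<nu> + 1) C" and 2: "bessel_bound \<sigma> (\<nu> + 2) C"
  shows "bessel_bound \<sigma> \<nu> ((\<bar>\<nu> + 1\<bar> + 1) * C)"
  unfolding bessel_bound_def
proof (intro conjI allI impI)
  have C: "C > 0" using 1 by (simp add: bessel_bound_def)
  then show "(\<bar>\<nu> + 1\<bar> + 1) * C > 0" by (simp add: add_nonneg_pos)
  fix w assume w: "\<sigma> * cmod w \<le> Re w"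
  define P where "P = 1 + cmod w"
  have P: "P \<ge> 1" "cmod (w / 2) \<le> P" by (simp_all add: P_def)
  define H where "H = (\<lambda>k. bessel_series (\<nu> + k) ((w / 2)\<^sup>2))"
  define G where "G = exp (Re w)"
  have G: "G > 0" by (simp add: G_def)
  have e: "- (\<nu> + 1) - 1 / 2 = - \<nu> - 3 / 2" "- (\<nu> + 2) - 1 / 2 = - \<nu> - 5 / 2"
    "- (\<nu> + 1) - 3 / 2 = - \<nu> - 5 / 2" "\<nu> + 1 + 1 = \<nu> + 2"
    by simp_all
  have H1: "cmod (H 1) \<le> C * P powr (- \<nu> - 3 / 2) * G"
    using bessel_boundD(1)[OF 1 w] unfolding H_def P_def G_def e .
  have H2: "cmod (H 2) \<le> C * P powr (- \<nu> - 5 / 2) * G"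
    using bessel_boundD(1)[OF 2 w] unfolding H_def P_def G_def e .
  have H12: "cmod (w / 2 * H 2 - H 1) \<le> C * P powr (- \<nu> - 5 / 2) * G"
    using bessel_boundD(2)[OF 1 w] unfolding H_def P_def G_def e by (simp only: norm_minus_commute)
  have rec: "bessel_series \<nu> ((w / 2)\<^sup>2) = of_real (\<nu> + 1) * H 1 + (w / 2)\<^sup>2 * H 2"
    unfolding H_def by (rule bessel_series_rec)
  have p1: "P * P powr e = P powr (e + 1)" for e
    using P(1) by (simp add: powr_add)
  have pw: "P powr (- \<nu> - 3 / 2) \<le> P powr (- \<nu> - 1 / 2)"
    "P * P * P powr (- \<nu> - 5 / 2) = P powr (- \<nu> - 1 / 2)"
    "P * P powr (- \<nu> - 5 / 2) = P powr (- \<nu> - 3 / 2)"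
    using P(1) by (auto intro!: powr_mono arg_cong[where f = "(powr) P"] simp: p1 mult.assoc)
  have "cmod (of_real (\<nu> + 1) * H 1 + (w / 2)\<^sup>2 * H 2) \<le> \<bar>\<nu> + 1\<bar> * cmod (H 1) + (cmod (w / 2))\<^sup>2 * cmod (H 2)"
    by (rule norm_triangle_le) (simp only: norm_mult norm_power norm_of_real order_refl)
  also have "\<dots> \<le> \<bar>\<nu> + 1\<bar> * (C * P powr (- \<nu> - 1 / 2) * G) + P\<^sup>2 * (C * P powr (- \<nu> - 5 / 2) * G)"
    using P H2 order.trans[OF H1 mult_right_mono[OF mult_left_mono[OF pw(1)]]] C G
    by (intro add_mono mult_mono power_mono) auto
  also have "P\<^sup>2 * (C * P powr (- \<nu> - 5 / 2) * G) = C * (P * P * P powr (- \<nu> - 5 / 2)) * G"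
    by (simp add: power2_eq_square)
  finally show "cmod (bessel_series \<nu> ((w / 2)\<^sup>2)) \<le> (\<bar>\<nu> + 1\<bar> + 1) * C * (1 + cmod w) powr (- \<nu> - 1 / 2) * exp (Re w)"
    unfolding rec[symmetric] pw(2) P_def[symmetric] G_def[symmetric] by (simp add: algebra_simps)
  \<comment> \<open>After inserting the recurrence, the difference for order
    \<open>\<nu> + 1\<close> reappears inside; its gain of one power offsets the factor
    \<open>w/2\<close>.\<close>
  have "bessel_series \<nu> ((w / 2)\<^sup>2) - w / 2 * H 1 = of_real (\<nu> + 1) * H 1 + w / 2 * (w / 2 * H 2 - H 1)"
    unfolding rec by (simp add: algebra_simps power2_eq_square)
  also have "cmod \<dots> \<le> \<bar>\<nu> + 1\<bar> * cmod (H 1) + cmod (w / 2) * cmod (w / 2 * H 2 - H 1)"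
    by (rule norm_triangle_le) (simp only: norm_mult norm_of_real order_refl)
  also have "\<dots> \<le> \<bar>\<nu> + 1\<bar> * (C * P powr (- \<nu> - 3 / 2) * G) + P * (C * P powr (- \<nu> - 5 / 2) * G)"
    using P H1 H12 by (intro add_mono mult_mono) auto
  also have "P * (C * P powr (- \<nu> - 5 / 2) * G) = C * (P * P powr (- \<nu> - 5 / 2)) * G" by simp
  finally show "cmod (bessel_series \<nu> ((w / 2)\<^sup>2) - w / 2 * bessel_series (\<nu> + 1) ((w / 2)\<^sup>2))
       \<le> (\<bar>\<nu> + 1\<bar> + 1) * C * (1 + cmod w) powr (- \<nu> - 3 / 2) * exp (Re w)"
    unfolding pw(3) P_def[symmetric] G_def[symmetric] H_def[symmetric] by (simp add: H_def algebra_simps)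
qed

text \<open>Induction on \<open>n\<close> lowers the threshold \<open>1/2 - n\<close> one unit at a
  time, starting from Poisson's range; each step uses the orders \<open>\<nu> + 1\<close> and
  \<open>\<nu> + 2\<close>, both already reached.\<close>

lemma bessel_bound_exists:
  assumes \<sigma>: "0 < \<sigma>" "\<sigma> \<le> 1"
  shows "\<exists>C. bessel_bound \<sigma> \<nu> C"
proof -
  have "\<forall>\<nu>. \<nu> > 1 / 2 - real n \<longrightarrow> (\<exists>C. bessel_bound \<sigma> \<nu> C)" for n
  proof (induction n)
    case 0
    then show ?case using bessel_bound_large_order[OF \<sigma>] by simp
  next
    case (Suc n)
    show ?case
    proof (intro allI impI)
      fix \<nu> :: real assume "\<nu> > 1 / 2 - real (Suc n)"
      then have "\<nu> + 1 > 1 / 2 - real n" "\<nu> + 2 > 1 / 2 - real n" by simp_all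
      then obtain C1 C2 where "bessel_bound \<sigma> (\<nu> + 1) C1" "bessel_bound \<sigma> (\<nu> + 2) C2"
        using Suc.IH by blast
      then have "bessel_bound \<sigma> (\<nu> + 1) (max C1 C2)" "bessel_bound \<sigma> (\<nu> + 2) (max C1 C2)"
        by (auto elim: bessel_bound_mono)
      then show "\<exists>C. bessel_bound \<sigma> \<nu> C" using bessel_bound_lower_order by blast
    qed
  qed
  moreover obtain n :: nat where "1 / 2 - \<nu> < real n" using reals_Archimedean2 by blast
  then have "\<nu> > 1 / 2 - real n" by simp
  ultimately show ?thesis by blast
qed

section \<open>Comparison of the weights\<close>

text \<open>The hypotheses amount to \<open>\<bar>ln x\<bar> \<le> ln L\<close>, so either sign of
  \<open>e\<close> is covered.\<close>

lemma powr_le_powr_abs: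
  fixes x L e :: real
  assumes "L \<ge> 1" "x \<le> L" "1 \<le> L * x"
  shows "x powr e \<le> L powr \<bar>e\<bar>"
proof -
  have x: "x > 0" using assms by (smt (verit) mult_nonneg_nonpos)
  have "0 \<le> ln L + ln x"
    using x assms ln_mult_pos[of L x] ln_ge_zero[of "L * x"] by simp
  moreover have "ln x \<le> ln L" using x assms by simp
  ultimately have "\<bar>ln x\<bar> \<le> ln L" by linarith
  then have "e * ln x \<le> \<bar>e\<bar> * ln L"
    by (metis abs_ge_self abs_ge_zero abs_mult mult_left_mono order.trans)
  then show ?thesis using x assms by (simp add: powr_def)
qed

text \<open>If \<open>R \<le> 2 * Y\<close>, the product \<open>Y * R\<close> controls
  \<open>R^2\<close>; otherwise \<open>R\<close> itself is below
  \<open>2 * \<bar>Y - R\<bar>\<close>. Conversely, \<open>Y \<le> R + \<bar>Y - R\<bar>\<close>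
  bounds the product. Swapping \<open>Y\<close> and \<open>R\<close> gives the same for
  \<open>max Y 1\<close>.\<close>

lemma square_max_1_bounds:
  fixes Y R :: real
  assumes Y: "Y > 0" and R: "R > 0"
  defines "P \<equiv> 1 + Y * R / 2" and "D \<equiv> 2 + 2 * \<bar>Y - R\<bar>"
  shows "(max R 1)\<^sup>2 \<le> D\<^sup>2 * P" and "P \<le> D\<^sup>2 * (max R 1)\<^sup>2"
proof -
  define d where "d = \<bar>Y - R\<bar>"
  have d: "d \<ge> 0" "Y \<le> R + d" "R \<le> Y + d" by (auto simp: d_def)
  have D: "D = 2 + 2 * d" by (simp add: D_def d_def)
  have P: "P \<ge> 1" using Y R by (simp add: P_def)
  have D1: "1 \<le> D\<^sup>2" "D \<le> D\<^sup>2" "4 \<le> D\<^sup>2"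
    using d power_mono[of 2 D 2] by (auto simp: D self_le_power)
  show "(max R 1)\<^sup>2 \<le> D\<^sup>2 * P"
  proof (cases "R \<le> 1")
    case True
    then show ?thesis using mult_mono[OF D1(1) P] D1 by (simp add: max_def)
  next
    case False
    have "R\<^sup>2 \<le> D\<^sup>2 * P"
    proof (cases "R / 2 \<le> Y")
      case True
      have "R\<^sup>2 = 4 * (R / 2 * R / 2)" by (simp add: power2_eq_square)
      also have "R / 2 * R / 2 \<le> Y * R / 2" using True R by (simp add: mult_right_mono)
      also have "\<dots> \<le> P" by (simp add: P_def)
      also have "4 * P \<le> D\<^sup>2 * P" using D1 P by (intro mult_right_mono) auto
      finally show ?thesis by simp
    next
      case False
      then have "R \<le> D" using d by (simp add: D)
      then have "R\<^sup>2 \<le> D\<^sup>2" using R by (intro power_mono) auto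
      also have "\<dots> \<le> D\<^sup>2 * P" using P by (simp add: mult_le_cancel_left1)
      finally show ?thesis .
    qed
    then show ?thesis using False by (simp add: max_def)
  qed
  define M where "M = max R 1"
  have M: "M \<ge> 1" "R \<le> M" by (auto simp: M_def)
  then have M2: "M \<le> M\<^sup>2" by (simp add: self_le_power)
  have "Y * R \<le> (M + d) * M" using d M R Y by (intro mult_mono) auto
  also have "\<dots> \<le> (1 + d) * M\<^sup>2"
    using mult_left_mono[OF M2 d(1)] by (simp add: algebra_simps power2_eq_square)
  finally have "P \<le> M\<^sup>2 + (1 + d) * M\<^sup>2 / 2"
    using order.trans[OF M(1) M2] unfolding P_def by linarith
  also have "\<dots> = (1 + (1 + d) / 2) * M\<^sup>2" by (simp add: field_simps)
  also have "\<dots> \<le> D * M\<^sup>2" using d by (intro mult_right_mono) (auto simp: D)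
  also have "\<dots> \<le> D\<^sup>2 * M\<^sup>2" using D1 by (intro mult_right_mono) auto
  finally show "P \<le> D\<^sup>2 * (max R 1)\<^sup>2" by (simp add: M_def)
qed

text \<open>By the two square bounds \<open>M^2 / P\<close> lies between \<open>D^-2\<close> and
  \<open>D^2\<close>, so it can be raised to a power of either sign.\<close>

lemma max_1_powr_bound:
  fixes Y R e :: real
  assumes Y: "Y > 0" and R: "R > 0"
  defines "P \<equiv> 1 + Y * R / 2" and "D \<equiv> 2 + 2 * \<bar>Y - R\<bar>"
  shows "max R 1 powr e * P powr (- (e / 2)) \<le> D powr \<bar>e\<bar>"
proof -
  have D: "D \<ge> 2" by (simp add: D_def)
  have P: "P \<ge> 1" using Y R by (simp add: P_def)
  define M where "M = max R 1"
  have M: "M \<ge> 1" by (simp add: M_def)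
  note b = square_max_1_bounds[OF Y R, folded P_def D_def M_def]
  have "M powr e * P powr (- (e / 2)) = (M\<^sup>2 / P) powr (e / 2)"
    using M P by (simp add: powr_divide powr_minus_divide powr_powr flip: powr_numeral)
  also have "\<dots> \<le> (D\<^sup>2) powr \<bar>e / 2\<bar>"
    using b P D by (intro powr_le_powr_abs) (auto simp: divide_simps)
  also have "\<dots> = D powr \<bar>e\<bar>" using D by (simp add: powr_powr flip: powr_numeral)
  finally show ?thesis by (simp add: M_def)
qed

text \<open>One of the two factors has base 1. The \<open>min\<close> factor stays in the final
  estimate; the \<open>max\<close> factor is traded for powers of \<open>D\<close>.\<close>

lemma min_max_1_powr:
  fixes x e :: real
  shows "x powr e = min x 1 powr e * max x 1 powr e"
  by (simp add: min_def max_def)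

text \<open>The first bound on \<open>X\<close> serves for \<open>Y \<le> 1\<close>, where a factor
  \<open>Y\<close> must survive, the second for larger \<open>Y\<close>. In the exponent
  \<open>\<bar>c\<bar> + 2\<close> the 2 comes from \<open>X\<close>, the rest from the powers of
  \<open>R\<close> and \<open>P\<close>.\<close>

lemma neumann_weight_bound:
  fixes Y R c X :: real
  assumes Y: "Y > 0" and R: "R > 0"
  defines "P \<equiv> 1 + Y * R / 2" and "D \<equiv> 2 + 2 * \<bar>Y - R\<bar>"
  assumes X: "X \<le> Y * (1 + R\<^sup>2 / P)" "X \<le> \<bar>Y - R\<bar> + R / P"
  shows "R powr c * P powr (- (c / 2)) * X \<le> 2 * D powr (\<bar>c\<bar> + 2) * min Y 1 * min R 1 powr c"
proof -
  have D: "D \<ge> 2" "D \<le> D\<^sup>2" "1 \<le> D\<^sup>2" by (auto simp: D_def self_le_power one_le_power)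
  have P: "P \<ge> 1" using Y R by (simp add: P_def)
  have "X \<le> 2 * D\<^sup>2 * min Y 1"
  proof (cases "Y \<le> 1")
    case True
    have "R\<^sup>2 \<le> (max R 1)\<^sup>2" using R by (intro power_mono) auto
    also have "\<dots> \<le> D\<^sup>2 * P" using square_max_1_bounds(1)[OF Y R] by (simp add: P_def D_def)
    finally have "R\<^sup>2 / P \<le> D\<^sup>2" using P by (simp add: divide_simps)
    then have "Y * (1 + R\<^sup>2 / P) \<le> Y * (2 * D\<^sup>2)" using D Y by (intro mult_left_mono) auto
    then show ?thesis using X(1) True by (simp add: mult.commute)
  next
    case False
    then have "1 * R \<le> Y * R" using R by (intro mult_right_mono) auto
    then have "R / 2 \<le> P" unfolding P_def by linarith
    then have "R / P \<le> 2" using P by (simp add: divide_simps)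
    then have "X \<le> \<bar>Y - R\<bar> + 2" by (rule order.trans[OF X(2) add_left_mono])
    also have "\<dots> \<le> D" using mult_right_mono[of 1 2 "\<bar>Y - R\<bar>"] by (simp add: D_def)
    finally have "X \<le> D" .
    then show ?thesis using D False by simp
  qed
  then have "min R 1 powr c * (max R 1 powr c * P powr (- (c / 2))) * X
     \<le> min R 1 powr c * (max R 1 powr c * P powr (- (c / 2))) * (2 * D\<^sup>2 * min Y 1)"
    by (intro mult_left_mono) auto
  also have "\<dots> \<le> min R 1 powr c * D powr \<bar>c\<bar> * (2 * D\<^sup>2 * min Y 1)"
    using Y max_1_powr_bound[OF Y R, of c] by (intro mult_right_mono mult_left_mono) (auto simp: P_def D_def)
  also have "\<dots> = 2 * D powr (\<bar>c\<bar> + 2) * min Y 1 * min R 1 powr c"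
    using D by (simp add: powr_add)
  finally show ?thesis by (subst min_max_1_powr[of R]) (simp only: mult.assoc)
qed

text \<open>\<open>k\<close> will be the size of the coefficient produced by differentiating
  \<open>y powr (1 - c)\<close>. In the exponent \<open>\<bar>c\<bar> + 3\<close> two powers come
  from \<open>A * B \<le> D^2 * P\<close>, one from \<open>1 + d \<le> D\<close>, and the rest from
  the powers of \<open>A\<close> and \<open>P\<close>.\<close>

lemma dirichlet_weight_bound:
  fixes Y R c k :: real
  assumes Y: "Y > 0" and R: "R > 0" and k: "k \<ge> 0"
  defines "P \<equiv> 1 + Y * R / 2" and "D \<equiv> 2 + 2 * \<bar>Y - R\<bar>"
  shows "R * Y powr (- c) * P powr (c / 2 - 1) * (k + Y * (\<bar>Y - R\<bar> + R / P) / 2)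
    \<le> (k + 1) * D powr (\<bar>c\<bar> + 3) * min Y 1 powr (- c) * min R 1"
proof -
  define d where "d = \<bar>Y - R\<bar>"
  define A where "A = max Y 1"
  define B where "B = max R 1"
  have AB: "A \<ge> 1" "B \<ge> 1" "Y \<le> A" by (auto simp: A_def B_def)
  have d: "d \<ge> 0" by (simp add: d_def)
  have D: "D \<ge> 2" "1 + d \<le> D" using d by (auto simp: D_def d_def)
  have P: "P \<ge> 1" using Y R by (simp add: P_def)
  have "A\<^sup>2 \<le> D\<^sup>2 * P" "B\<^sup>2 \<le> D\<^sup>2 * P"
    using square_max_1_bounds(1)[OF Y R] square_max_1_bounds(1)[OF R Y]
    by (simp_all add: P_def D_def A_def B_def mult.commute abs_minus_commute)
  \<comment> \<open>Multiplying the square bounds for \<open>Y\<close> and \<open>R\<close> and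
    taking the root bounds \<open>A * B\<close>.\<close>
  then have "A\<^sup>2 * B\<^sup>2 \<le> (D\<^sup>2 * P) * (D\<^sup>2 * P)" using P by (intro mult_mono) auto
  then have AB2: "(A * B)\<^sup>2 \<le> (D\<^sup>2 * P)\<^sup>2"
    unfolding power_mult_distrib[of A B] power2_eq_square[of "D\<^sup>2 * P"] .
  have ABP: "A * B \<le> D\<^sup>2 * P" by (rule power2_le_imp_le[OF AB2]) (use P in simp)
  have "Y * R / P \<le> 2" using P by (simp add: divide_simps P_def)
  then have "k + Y * (d + R / P) / 2 \<le> k + (1 + Y * d)"
    using Y d by (simp add: algebra_simps) (smt (verit) mult_nonneg_nonneg)
  also have "\<dots> \<le> (k + 1) * (1 + Y * d)"
    using k Y d by (simp add: algebra_simps)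
  also have "\<dots> \<le> (k + 1) * (A * D)"
  proof -
    have "1 + Y * d \<le> A * (1 + d)" using AB mult_right_mono[OF AB(3) d] by (simp add: algebra_simps)
    also have "\<dots> \<le> A * D" using AB D by (intro mult_left_mono) auto
    finally show ?thesis using k by (intro mult_left_mono) auto
  qed
  finally have 1: "k + Y * (d + R / P) / 2 \<le> (k + 1) * (A * D)" .
  have "A powr (- c) * P powr (- (- c / 2)) \<le> D powr \<bar>- c\<bar>"
    using max_1_powr_bound[OF R Y, of "- c"]
    by (simp add: P_def D_def A_def mult.commute abs_minus_commute)
  then have 2: "A powr (- c) * P powr (c / 2) \<le> D powr \<bar>c\<bar>" by simp
  have "R * Y powr (- c) * P powr (c / 2 - 1) * (k + Y * (d + R / P) / 2)
      \<le> R * Y powr (- c) * P powr (c / 2 - 1) * ((k + 1) * (A * D))"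
    using R by (intro mult_left_mono 1) auto
  also have "\<dots> = min R 1 * B * (min Y 1 powr (- c) * A powr (- c)) * P powr (c / 2 - 1) * ((k + 1) * (A * D))"
  proof -
    have "min R 1 * B = R" "min Y 1 powr (- c) * A powr (- c) = Y powr (- c)"
      by (simp_all add: A_def B_def min_def max_def)
    then show ?thesis by (simp only:)
  qed
  also have "\<dots>
    = (A powr (- c) * P powr (c / 2)) * (A * B / P) * ((k + 1) * D * min Y 1 powr (- c) * min R 1)"
    using P by (simp add: powr_diff)
  also have "\<dots> \<le> D powr \<bar>c\<bar> * D\<^sup>2 * ((k + 1) * D * min Y 1 powr (- c) * min R 1)"
    using ABP P D k R AB by (intro mult_mono 2) (auto simp: divide_simps)
  also have "\<dots> = (k + 1) * D powr (\<bar>c\<bar> + 3) * min Y 1 powr (- c) * min R 1"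
    using D by (simp add: powr_add power2_eq_square power3_eq_cube)
  finally show ?thesis by (simp only: d_def)
qed

text \<open>Since \<open>D^2 \<le> 8 + 8 * d^2\<close>, growth at rate \<open>\<sigma> / 64\<close>
  in \<open>D^2\<close> costs just half of the Gaussian exponent and a constant
  \<open>exp (\<sigma> / 8)\<close>.\<close>

lemma powr_gaussian_bound:
  fixes \<sigma> N :: real
  assumes "\<sigma> > 0" "N \<ge> 0"
  shows "\<exists>K > 0. \<forall>d \<ge> 0. (2 + 2 * d) powr N * exp (- (\<sigma> * d\<^sup>2 / 4)) \<le> K * exp (- (\<sigma> * d\<^sup>2 / 8))"
proof -
  obtain K where K: "K > 0" "\<And>u. u \<ge> 0 \<Longrightarrow> u powr (N / 2) \<le> K * exp (\<sigma> / 64 * u)"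
    using powr_le_exp[of "N / 2" "\<sigma> / 64"] assms by (intro that[of "((N / 2 + 1) / (\<sigma> / 64)) powr (N / 2)"]) auto
  show ?thesis
  proof (intro exI[of _ "K * exp (\<sigma> / 8)"] conjI allI impI)
    show "K * exp (\<sigma> / 8) > 0" using K by simp
    fix d :: real assume d: "d \<ge> 0"
    define D where "D = 2 + 2 * d"
    have "D\<^sup>2 \<le> 8 + 8 * d\<^sup>2"
      using zero_le_power2[of "1 - d"] by (simp add: D_def power2_eq_square algebra_simps)
    then have e: "\<sigma> / 64 * D\<^sup>2 \<le> \<sigma> / 8 + \<sigma> * d\<^sup>2 / 8"
      using mult_left_mono[of "D\<^sup>2" "8 + 8 * d\<^sup>2" "\<sigma> / 64"] assms by (simp add: algebra_simps)
    have "D powr N = (D\<^sup>2) powr (N / 2)" using d by (simp add: D_def powr_powr flip: powr_numeral)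
    also have "\<dots> \<le> K * exp (\<sigma> / 64 * D\<^sup>2)" by (rule K) simp
    also have "\<dots> \<le> K * exp (\<sigma> / 8 + \<sigma> * d\<^sup>2 / 8)" using e K by simp
    finally have "D powr N * exp (- (\<sigma> * d\<^sup>2 / 4)) \<le> K * exp (\<sigma> / 8 + \<sigma> * d\<^sup>2 / 8) * exp (- (\<sigma> * d\<^sup>2 / 4))"
      by (intro mult_right_mono) auto
    also have "\<dots> = K * exp (\<sigma> / 8) * exp (- (\<sigma> * d\<^sup>2 / 8))"
      by (simp add: mult.assoc flip: exp_add)
    finally show "(2 + 2 * d) powr N * exp (- (\<sigma> * d\<^sup>2 / 4)) \<le> K * exp (\<sigma> / 8) * exp (- (\<sigma> * d\<^sup>2 / 8))"
      by (simp add: D_def)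
  qed
qed

section \<open>The kernels and their derivatives\<close>

text \<open>Here \<open>of_real (y * \<rho>) / (2 * z)\<close> is the argument \<open>w\<close> of
  the Bessel function. No real power of \<open>y\<close> is left, so for nonzero \<open>z\<close>
  this is the restriction of an entire function of \<open>y\<close>.\<close>

definition bessel_kernel :: "real \<Rightarrow> complex \<Rightarrow> real \<Rightarrow> real \<Rightarrow> complex" where
  "bessel_kernel \<nu> z y \<rho> = exp (- of_real (y\<^sup>2 + \<rho>\<^sup>2) / (4 * z))
     * bessel_series \<nu> ((of_real (y * \<rho>) / (2 * z) / 2)\<^sup>2)"

text \<open>The bracket keeps \<open>w/2\<close> next to the series of order
  \<open>\<nu> + 1\<close>, so that the difference estimate of \<open>bessel_bound\<close> applies
  to it.\<close>

definition bessel_kernel_deriv :: "real \<Rightarrow> complex \<Rightarrow> real \<Rightarrow> real \<Rightarrow> complex" where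
  "bessel_kernel_deriv \<nu> z y \<rho> = - exp (- of_real (y\<^sup>2 + \<rho>\<^sup>2) / (4 * z)) / (2 * z)
     * (of_real y * bessel_series \<nu> ((of_real (y * \<rho>) / (2 * z) / 2)\<^sup>2)
       - of_real \<rho> * (of_real (y * \<rho>) / (2 * z) / 2
           * bessel_series (\<nu> + 1) ((of_real (y * \<rho>) / (2 * z) / 2)\<^sup>2)))"

text \<open>The kernel is differentiated in a complex variable \<open>\<zeta>\<close> and then
  restricted to the real line.\<close>

lemma has_vector_derivative_bessel_kernel:
  assumes z: "z \<noteq> 0"
  shows "((\<lambda>t. bessel_kernel \<nu> z t \<rho>) has_vector_derivative bessel_kernel_deriv \<nu> z y \<rho>) (at y)"
proof -
  define f where "f = (\<lambda>\<zeta>. exp (- (\<zeta>\<^sup>2 + of_real (\<rho>\<^sup>2)) / (4 * z))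
     * bessel_series \<nu> ((\<zeta> * of_real \<rho> / (2 * z) / 2)\<^sup>2))"
  have "(f has_field_derivative bessel_kernel_deriv \<nu> z y \<rho>) (at (of_real y))"
    unfolding f_def bessel_kernel_deriv_def
    by (rule derivative_eq_intros DERIV_chain2[OF DERIV_bessel_series] refl | simp add: z)+
      (use z in \<open>simp add: divide_simps power2_eq_square\<close>, simp add: algebra_simps)
  from has_vector_derivative_real_field[OF this, of UNIV]
  show ?thesis by (simp add: f_def bessel_kernel_def[abs_def])
qed

lemma powr_of_real_mult_left:
  "x > 0 \<Longrightarrow> (of_real x * v) powr of_real a = of_real (x powr a) * (v :: complex) powr of_real a"
  by (simp add: powr_times_real_left powr_of_real)

text \<open>The two powers of \<open>y * \<rho>\<close> have opposite exponents and cancel, so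
  \<open>y\<close> enters only through \<open>bessel_kernel\<close>.\<close>

lemma p_Bn_eq_bessel_kernel:
  assumes "y > 0" "\<rho> > 0" "z \<noteq> 0"
  shows "p_Bn c z y \<rho> = 1 / (2 * z) * of_real (\<rho> powr c) * (1 / (4 * z)) powr of_real ((c - 1) / 2)
    * bessel_kernel ((c - 1) / 2) z y \<rho>"
proof -
  have "(of_real (y * \<rho>) / (2 * z) / 2) powr of_real ((c - 1) / 2)
      = (of_real (y * \<rho>) * (1 / (4 * z))) powr of_real ((c - 1) / 2)"
    by simp
  also have "\<dots> = of_real ((y * \<rho>) powr ((c - 1) / 2)) * (1 / (4 * z)) powr of_real ((c - 1) / 2)"
    using assms by (intro powr_of_real_mult_left) simp
  finally have 1: "(of_real (y * \<rho>) / (2 * z) / 2) powr of_real ((c - 1) / 2)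
      = of_real ((y * \<rho>) powr ((c - 1) / 2)) * (1 / (4 * z)) powr of_real ((c - 1) / 2)" .
  have "(y * \<rho>) powr ((1 - c) / 2) * (y * \<rho>) powr ((c - 1) / 2) = 1"
    using assms by (simp flip: powr_add add_divide_distrib)
  then have "complex_of_real ((y * \<rho>) powr ((1 - c) / 2)) * of_real ((y * \<rho>) powr ((c - 1) / 2)) = 1"
    by (simp only: flip: of_real_mult) simp
  then have 2: "complex_of_real ((y * \<rho>) powr ((1 - c) / 2)) * (of_real ((y * \<rho>) powr ((c - 1) / 2)) * u) = u" for u
    by (simp only: mult.assoc[symmetric]) simp
  show ?thesis
    unfolding p_Bn_def bessel_I_eq bessel_kernel_def 1 of_real_mult[of "\<rho> powr c"]
    using 2[of "1 / (2 * z) * of_real (\<rho> powr c) * exp (- of_real (y\<^sup>2 + \<rho>\<^sup>2) / (4 * z))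
      * (1 / (4 * z)) powr of_real ((c - 1) / 2)
      * bessel_series ((c - 1) / 2) ((of_real (y * \<rho>) / (2 * z) / 2)\<^sup>2)"]
    by (simp only: mult_ac)
qed

text \<open>Here the powers of \<open>y * \<rho>\<close> combine to
  \<open>(y * \<rho>) powr (1 - c)\<close>, which together with \<open>\<rho> powr c\<close> leaves
  \<open>\<rho> * y powr (1 - c)\<close>.\<close>

lemma p_Bd_eq_bessel_kernel:
  assumes "y > 0" "\<rho> > 0" "z \<noteq> 0"
  shows "p_Bd c z y \<rho> = 1 / (2 * z) * of_real \<rho> * (1 / (4 * z)) powr of_real ((1 - c) / 2)
    * (of_real (y powr (1 - c)) * bessel_kernel ((1 - c) / 2) z y \<rho>)"
proof -
  have "(of_real (y * \<rho>) / (2 * z) / 2) powr of_real ((1 - c) / 2)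
      = (of_real (y * \<rho>) * (1 / (4 * z))) powr of_real ((1 - c) / 2)"
    by simp
  also have "\<dots> = of_real ((y * \<rho>) powr ((1 - c) / 2)) * (1 / (4 * z)) powr of_real ((1 - c) / 2)"
    using assms by (intro powr_of_real_mult_left) simp
  finally have 1: "(of_real (y * \<rho>) / (2 * z) / 2) powr of_real ((1 - c) / 2)
      = of_real ((y * \<rho>) powr ((1 - c) / 2)) * (1 / (4 * z)) powr of_real ((1 - c) / 2)" .
  have "\<rho> powr c * (y * \<rho>) powr ((1 - c) / 2) * (y * \<rho>) powr ((1 - c) / 2) = \<rho> powr c * (y * \<rho>) powr (1 - c)"
    by (simp add: mult.assoc flip: powr_add)
  also have "\<dots> = \<rho> * y powr (1 - c)" using assms by (simp add: powr_mult powr_diff)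
  finally have "complex_of_real (\<rho> powr c * (y * \<rho>) powr ((1 - c) / 2)) * of_real ((y * \<rho>) powr ((1 - c) / 2))
      = of_real (\<rho> * y powr (1 - c))"
    by (simp only: flip: of_real_mult)
  then have 2: "complex_of_real (\<rho> powr c * (y * \<rho>) powr ((1 - c) / 2)) * (of_real ((y * \<rho>) powr ((1 - c) / 2)) * u)
      = of_real \<rho> * (of_real (y powr (1 - c)) * u)" for u
    by (simp only: mult.assoc[symmetric]) simp
  show ?thesis
    unfolding p_Bd_def bessel_I_eq bessel_kernel_def 1
    using 2[of "1 / (2 * z) * exp (- of_real (y\<^sup>2 + \<rho>\<^sup>2) / (4 * z)) * (1 / (4 * z)) powr of_real ((1 - c) / 2)
      * bessel_series ((1 - c) / 2) ((of_real (y * \<rho>) / (2 * z) / 2)\<^sup>2)"]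
    by (simp only: mult_ac)
qed

text \<open>The factored form is available for positive arguments only, so the derivative is
  transferred on the open half-line.\<close>

lemma vector_derivative_p_Bn:
  assumes y: "y > 0" "\<rho> > 0" "z \<noteq> 0"
  shows "vector_derivative (\<lambda>t. p_Bn c z t \<rho>) (at y)
    = 1 / (2 * z) * of_real (\<rho> powr c) * (1 / (4 * z)) powr of_real ((c - 1) / 2)
      * bessel_kernel_deriv ((c - 1) / 2) z y \<rho>"
proof (rule vector_derivative_at, rule has_vector_derivative_transform_within_open)
  show "((\<lambda>t. 1 / (2 * z) * of_real (\<rho> powr c) * (1 / (4 * z)) powr of_real ((c - 1) / 2)
      * bessel_kernel ((c - 1) / 2) z t \<rho>) has_vector_derivative
      1 / (2 * z) * of_real (\<rho> powr c) * (1 / (4 * z)) powr of_real ((c - 1) / 2)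
      * bessel_kernel_deriv ((c - 1) / 2) z y \<rho>) (at y)"
    by (intro has_vector_derivative_mult_right has_vector_derivative_bessel_kernel y)
qed (use y in \<open>auto simp: p_Bn_eq_bessel_kernel intro: open_greaterThan\<close>)

lemma vector_derivative_p_Bd:
  assumes y: "y > 0" "\<rho> > 0" "z \<noteq> 0"
  shows "vector_derivative (\<lambda>t. p_Bd c z t \<rho>) (at y)
    = 1 / (2 * z) * of_real \<rho> * (1 / (4 * z)) powr of_real ((1 - c) / 2)
      * (of_real (y powr (1 - c)) * bessel_kernel_deriv ((1 - c) / 2) z y \<rho>
         + of_real ((1 - c) * y powr (- c)) * bessel_kernel ((1 - c) / 2) z y \<rho>)"
proof (rule vector_derivative_at, rule has_vector_derivative_transform_within_open)
  have "((\<lambda>t. t powr (1 - c)) has_real_derivative (1 - c) * y powr (- c)) (at y)"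
    using y by (auto intro!: derivative_eq_intros)
  then have "((\<lambda>t. complex_of_real (t powr (1 - c))) has_vector_derivative of_real ((1 - c) * y powr (- c))) (at y)"
    by (intro has_vector_derivative_of_real) (simp add: has_real_derivative_iff_has_vector_derivative)
  then show "((\<lambda>t. 1 / (2 * z) * of_real \<rho> * (1 / (4 * z)) powr of_real ((1 - c) / 2)
      * (of_real (t powr (1 - c)) * bessel_kernel ((1 - c) / 2) z t \<rho>)) has_vector_derivative
      1 / (2 * z) * of_real \<rho> * (1 / (4 * z)) powr of_real ((1 - c) / 2)
      * (of_real (y powr (1 - c)) * bessel_kernel_deriv ((1 - c) / 2) z y \<rho>
         + of_real ((1 - c) * y powr (- c)) * bessel_kernel ((1 - c) / 2) z y \<rho>)) (at y)"
    by (intro has_vector_derivative_mult_right has_vector_derivative_mult has_vector_derivative_bessel_kernel y)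
qed (use y in \<open>auto simp: p_Bd_eq_bessel_kernel intro: open_greaterThan\<close>)

section \<open>Scaled estimates of the kernels\<close>

text \<open>Lengths are measured in units of \<open>s\<close>. The first entry of the minimum keeps
  the factor \<open>Y\<close> wanted for small \<open>Y\<close>; the second uses the cancellation
  between consecutive orders.\<close>

lemma bessel_kernel_bounds:
  fixes z :: complex and y \<rho> :: real
  assumes \<sigma>: "\<sigma> > 0" and z: "z \<noteq> 0" "\<sigma> * cmod z \<le> Re z" and Y: "Y > 0" and R: "R > 0"
    and bound: "bessel_bound \<sigma> \<nu> C" "bessel_bound \<sigma> (\<nu> + 1) C"
  defines "s \<equiv> sqrt (cmod z)" and "P \<equiv> 1 + Y * R / 2"
    and "G \<equiv> exp (- (\<sigma> * \<bar>Y - R\<bar>\<^sup>2 / 4))"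
  shows "cmod (bessel_kernel \<nu> z (s * Y) (s * R)) \<le> C * P powr (- \<nu> - 1 / 2) * G"
    and "cmod (bessel_kernel_deriv \<nu> z (s * Y) (s * R))
      \<le> C * P powr (- \<nu> - 1 / 2) * G / (2 * s) * min (Y * (1 + R\<^sup>2 / P)) (\<bar>Y - R\<bar> + R / P)"
proof -
  define w where "w = of_real ((s * Y) * (s * R)) / (2 * z)"
  define E where "E = exp (- of_real ((s * Y)\<^sup>2 + (s * R)\<^sup>2) / (4 * z))"
  define H where "H = bessel_series \<nu> ((w / 2)\<^sup>2)"
  define H' where "H' = bessel_series (\<nu> + 1) ((w / 2)\<^sup>2)"
  define Q where "Q = P powr (- \<nu> - 1 / 2)"
  have C: "C > 0" using bound by (simp add: bessel_bound_def)
  have s: "s > 0" "s\<^sup>2 = cmod z" using z by (auto simp: s_def)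
  have P: "P \<ge> 1" using Y R by (simp add: P_def)
  have cw: "cmod w = Y * R / 2"
    using Y R s by (simp add: w_def norm_divide norm_mult field_simps power2_eq_square flip: s(2))
  then have Pw: "1 + cmod w = P" by (simp add: P_def)
  have re: "Re (of_real r * u) = r * Re u" for r u by simp
  have inv: "Re (1 / z) = Re z / (cmod z)\<^sup>2" by (simp add: Re_divide cmod_power2)
  \<comment> \<open>This lower bound places \<open>w\<close>, a positive multiple of
    \<open>1 / z\<close>, in the sector and also fixes the Gaussian rate.\<close>
  have inv_ge: "\<sigma> / s\<^sup>2 \<le> Re (1 / z)"
    using z s(1) unfolding inv s(2)[symmetric] by (simp add: divide_simps power2_eq_square)
  have Rw: "Re w = s\<^sup>2 * Y * R / 2 * Re (1 / z)"
  proof -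
    have "w = of_real (s\<^sup>2 * Y * R / 2) * (1 / z)" by (simp add: w_def power2_eq_square)
    then show ?thesis by (simp only: re)
  qed
  have "\<sigma> * cmod w = s\<^sup>2 * Y * R / 2 * (\<sigma> / s\<^sup>2)" using s z(1) by (simp add: cw)
  also have "\<dots> \<le> Re w" unfolding Rw using Y R by (intro mult_left_mono inv_ge) auto
  finally have w: "\<sigma> * cmod w \<le> Re w" .
  have EG: "cmod E * exp (Re w) \<le> G"
  proof -
    have "- of_real ((s * Y)\<^sup>2 + (s * R)\<^sup>2) / (4 * z) = of_real (- s\<^sup>2 * (Y\<^sup>2 + R\<^sup>2) / 4) * (1 / z)"
      using z(1) by (simp add: power_mult_distrib field_simps)
    then have ReE: "Re (- of_real ((s * Y)\<^sup>2 + (s * R)\<^sup>2) / (4 * z)) = - s\<^sup>2 * (Y\<^sup>2 + R\<^sup>2) / 4 * Re (1 / z)"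
      by (simp only: re)
    \<comment> \<open>The cross term \<open>Y * R\<close> from \<open>exp (Re w)\<close> completes
      the square.\<close>
    have "cmod E * exp (Re w) = exp (- (s\<^sup>2 * \<bar>Y - R\<bar>\<^sup>2 / 4 * Re (1 / z)))"
      unfolding E_def norm_exp_eq_Re ReE Rw
      by (simp only: flip: exp_add) (simp add: power2_eq_square field_simps)
    also have "s\<^sup>2 * \<bar>Y - R\<bar>\<^sup>2 / 4 * Re (1 / z) \<ge> s\<^sup>2 * \<bar>Y - R\<bar>\<^sup>2 / 4 * (\<sigma> / s\<^sup>2)"
      by (intro mult_left_mono inv_ge) simp
    then have "exp (- (s\<^sup>2 * \<bar>Y - R\<bar>\<^sup>2 / 4 * Re (1 / z))) \<le> G"
      using s z(1) by (simp add: G_def mult.commute)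
    finally show ?thesis .
  qed
  have QP: "P powr (- \<nu> - 3 / 2) = Q / P"
  proof -
    have "P powr (e - 1) = P powr e / P" for e using P by (simp add: powr_diff)
    moreover have "- \<nu> - 3 / 2 = (- \<nu> - 1 / 2) - 1" by simp
    ultimately show ?thesis unfolding Q_def by metis
  qed
  have bH: "cmod H \<le> C * Q * exp (Re w)"
    using bessel_boundD(1)[OF bound(1) w] by (simp only: H_def Q_def Pw)
  have bD: "cmod (H - w / 2 * H') \<le> C * (Q / P) * exp (Re w)"
    using bessel_boundD(2)[OF bound(1) w] by (simp only: H_def H'_def QP Pw)
  have bH': "cmod H' \<le> C * (Q / P) * exp (Re w)"
  proof -
    have e: "- (\<nu> + 1) - 1 / 2 = - \<nu> - 3 / 2" by simp
    show ?thesis using bessel_boundD(1)[OF bound(2) w] unfolding H'_def QP[symmetric] Pw e .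
  qed
  have QG: "C * Q * X * (cmod E * exp (Re w)) \<le> C * Q * X * G" if "X \<ge> 0" for X
    using C that by (intro mult_left_mono EG) (auto simp: Q_def)
  have "cmod (bessel_kernel \<nu> z (s * Y) (s * R)) = cmod E * cmod H"
    by (simp only: bessel_kernel_def w_def E_def H_def norm_mult)
  also have "\<dots> \<le> cmod E * (C * Q * exp (Re w))" by (intro mult_left_mono bH) simp
  also have "\<dots> \<le> C * Q * G" using QG[of 1] by (simp add: mult_ac)
  finally show "cmod (bessel_kernel \<nu> z (s * Y) (s * R)) \<le> C * P powr (- \<nu> - 1 / 2) * G"
    by (simp only: Q_def)
  define T where "T = of_real Y * H - of_real R * (w / 2 * H')"
  have "cmod T \<le> Y * (C * Q * exp (Re w) + R\<^sup>2 * (C * (Q / P) * exp (Re w)))"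
  proof -
    \<comment> \<open>\<open>w\<close> contains the factor \<open>Y\<close>, so \<open>Y\<close> can
      be pulled out of both terms of \<open>T\<close>.\<close>
    have w2: "of_real R * (w / 2) = of_real Y * (of_real (s\<^sup>2 * R\<^sup>2 / 4) / z)"
      by (simp add: w_def power2_eq_square)
    have "T = of_real Y * (H - of_real (s\<^sup>2 * R\<^sup>2 / 4) / z * H')"
      unfolding T_def mult.assoc[symmetric] w2 by (simp add: algebra_simps)
    then have "cmod T = Y * cmod (H - of_real (s\<^sup>2 * R\<^sup>2 / 4) / z * H')" using Y by (simp add: norm_mult)
    also have "\<dots> \<le> Y * (cmod H + cmod (of_real (s\<^sup>2 * R\<^sup>2 / 4) / z * H'))"
      using Y by (intro mult_left_mono norm_triangle_ineq4) auto
    also have "cmod (of_real (s\<^sup>2 * R\<^sup>2 / 4) / z * H') = R\<^sup>2 / 4 * cmod H'"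
      using z by (simp add: norm_mult norm_divide norm_power s(2))
    also have "Y * (cmod H + R\<^sup>2 / 4 * cmod H') \<le> Y * (C * Q * exp (Re w) + R\<^sup>2 * (C * (Q / P) * exp (Re w)))"
      using Y bH bH' by (intro mult_left_mono add_mono mult_mono) auto
    finally show ?thesis .
  qed
  then have T1: "cmod T \<le> C * Q * (Y * (1 + R\<^sup>2 / P)) * exp (Re w)" by (simp add: algebra_simps)
  have "cmod T \<le> \<bar>Y - R\<bar> * (C * Q * exp (Re w)) + R * (C * (Q / P) * exp (Re w))"
  proof -
    have "T = of_real (Y - R) * H + of_real R * (H - w / 2 * H')" by (simp add: T_def algebra_simps)
    also have "cmod \<dots> \<le> \<bar>Y - R\<bar> * cmod H + R * cmod (H - w / 2 * H')"
      using R by (intro norm_triangle_le) (simp add: norm_mult del: of_real_diff)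
    also have "\<dots> \<le> \<bar>Y - R\<bar> * (C * Q * exp (Re w)) + R * (C * (Q / P) * exp (Re w))"
      using R by (intro add_mono mult_left_mono bH bD) auto
    finally show ?thesis .
  qed
  then have T2: "cmod T \<le> C * Q * (\<bar>Y - R\<bar> + R / P) * exp (Re w)" by (simp add: algebra_simps)
  define X where "X = min (Y * (1 + R\<^sup>2 / P)) (\<bar>Y - R\<bar> + R / P)"
  have X0: "X \<ge> 0" using Y R P by (simp add: X_def)
  have TX: "cmod T \<le> C * Q * X * exp (Re w)" using T1 T2 by (simp add: X_def min_def)
  have "bessel_kernel_deriv \<nu> z (s * Y) (s * R) = - E / (2 * z) * (of_real s * T)"
    unfolding bessel_kernel_deriv_def T_def w_def[symmetric] E_def[symmetric] H_def[symmetric] H'_def[symmetric]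
    by (simp add: algebra_simps)
  then have "cmod (bessel_kernel_deriv \<nu> z (s * Y) (s * R)) = cmod E * cmod T / (2 * s)"
    using s by (simp add: norm_mult norm_divide field_simps power2_eq_square flip: s(2))
  also have "\<dots> \<le> cmod E * (C * Q * X * exp (Re w)) / (2 * s)"
    using s by (intro divide_right_mono mult_left_mono TX) auto
  also have "\<dots> \<le> C * Q * X * G / (2 * s)"
    using QG[OF X0] s by (intro divide_right_mono) (auto simp: mult_ac)
  finally show "cmod (bessel_kernel_deriv \<nu> z (s * Y) (s * R))
      \<le> C * P powr (- \<nu> - 1 / 2) * G / (2 * s) * min (Y * (1 + R\<^sup>2 / P)) (\<bar>Y - R\<bar> + R / P)"
    by (simp add: X_def Q_def mult_ac)
qed

text \<open>A real exponent makes the modulus depend on \<open>cmod z\<close> alone; it is written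
  through \<open>sqrt (cmod z)\<close>, the unit of length used in the scaling.\<close>

lemma norm_prefactor:
  assumes "z \<noteq> 0"
  shows "cmod ((1 / (4 * z)) powr of_real \<nu>) = 4 powr (- \<nu>) * sqrt (cmod z) powr (- 2 * \<nu>)"
proof -
  have "cmod ((1 / (4 * z)) powr of_real \<nu>) = (1 / (4 * cmod z)) powr \<nu>"
    by (simp add: norm_powr_real_powr' norm_divide norm_mult)
  also have "\<dots> = 4 powr (- \<nu>) * cmod z powr (- \<nu>)"
    by (simp add: powr_divide powr_mult powr_minus_divide)
  also have "cmod z powr (- \<nu>) = (cmod z powr (1 / 2)) powr (- 2 * \<nu>)"
    by (simp add: powr_powr)
  finally show ?thesis by (simp add: powr_half_sqrt)
qed

text \<open>Scaling reduces the estimate to \<open>neumann_weight_bound\<close>; the resulting power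
  of \<open>2 + 2 * d\<close> is paid for with half of the Gaussian, whence the constant
  \<open>8 / \<sigma>\<close>.\<close>

lemma p_Bn_deriv_bound:
  assumes \<sigma>: "\<sigma> > 0" "\<sigma> \<le> 1"
  shows "\<exists>C > 0. \<forall>z y \<rho>. z \<noteq> 0 \<longrightarrow> \<sigma> * cmod z \<le> Re z \<longrightarrow> y > 0 \<longrightarrow> \<rho> > 0 \<longrightarrow>
      cmod (vector_derivative (\<lambda>t. p_Bn c z t \<rho>) (at y))
        \<le> C * inverse (cmod z) * min (y / sqrt (cmod z)) 1
            * (min (\<rho> / sqrt (cmod z)) 1) powr c
            * exp (- (\<bar>y - \<rho>\<bar>\<^sup>2 / (8 / \<sigma> * cmod z)))"
proof -
  define \<nu> where "\<nu> = (c - 1) / 2"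
  obtain C1 C2 where "bessel_bound \<sigma> \<nu> C1" "bessel_bound \<sigma> (\<nu> + 1) C2"
    using bessel_bound_exists[OF \<sigma>] by meson
  then obtain C where C: "bessel_bound \<sigma> \<nu> C" "bessel_bound \<sigma> (\<nu> + 1) C"
    by (meson bessel_bound_mono max.cobounded1 max.cobounded2)
  then have C0: "C > 0" by (simp add: bessel_bound_def)
  obtain K where K: "K > 0" "\<And>d. d \<ge> 0 \<Longrightarrow> (2 + 2 * d) powr (\<bar>c\<bar> + 2) * exp (- (\<sigma> * d\<^sup>2 / 4)) \<le> K * exp (- (\<sigma> * d\<^sup>2 / 8))"
    using powr_gaussian_bound[OF \<sigma>(1), of "\<bar>c\<bar> + 2"] by auto
  \<comment> \<open>Collects \<open>4 powr (- \<nu>)\<close> and the two factors 1/2, one from the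
    prefactor and one from the derivative bound.\<close>
  define L where "L = 4 powr (- \<nu>) / 4 * C"
  have L: "L > 0" using C0 by (simp add: L_def)
  show ?thesis
  proof (intro exI[of _ "2 * L * K"] conjI allI impI)
    show "2 * L * K > 0" using L K by simp
    fix z :: complex and y \<rho> :: real
    assume z: "z \<noteq> 0" "\<sigma> * cmod z \<le> Re z" and y: "y > 0" and \<rho>: "\<rho> > 0"
    define s where "s = sqrt (cmod z)"
    define Y where "Y = y / s"
    define R where "R = \<rho> / s"
    have s: "s > 0" "cmod z = s\<^sup>2" using z by (auto simp: s_def)
    have YR: "Y > 0" "R > 0" "y = s * Y" "\<rho> = s * R" using s y \<rho> by (auto simp: Y_def R_def)
    define P where "P = 1 + Y * R / 2"
    define d where "d = \<bar>Y - R\<bar>"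
    define G where "G = exp (- (\<sigma> * d\<^sup>2 / 4))"
    define X where "X = min (Y * (1 + R\<^sup>2 / P)) (d + R / P)"
    have bk: "cmod (bessel_kernel_deriv \<nu> z y \<rho>) \<le> C * P powr (- (c / 2)) * G / (2 * s) * X"
    proof -
      have e: "- \<nu> - 1 / 2 = - (c / 2)" by (simp add: \<nu>_def field_simps)
      show ?thesis
        using bessel_kernel_bounds(2)[OF \<sigma>(1) z YR(1,2) C]
        unfolding s_def[symmetric] YR(3,4)[symmetric] P_def[symmetric] d_def[symmetric] G_def[symmetric] X_def[symmetric] e .
    qed
    \<comment> \<open>Because \<open>c - 2 * \<nu> = 1\<close>, a single power of \<open>s\<close>
      remains; it cancels the \<open>1 / s\<close> of the derivative bound.\<close>
    have pre: "\<rho> powr c * cmod ((1 / (4 * z)) powr of_real \<nu>) = 4 powr (- \<nu>) * s * R powr c"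
    proof -
      have "c + - 2 * \<nu> = 1" by (simp add: \<nu>_def field_simps)
      then have "s powr c * s powr (- 2 * \<nu>) = s powr 1" by (simp only: flip: powr_add)
      then show ?thesis using s unfolding norm_prefactor[OF z(1)] s_def[symmetric] YR(4) powr_mult by simp
    qed
    have "cmod (vector_derivative (\<lambda>t. p_Bn c z t \<rho>) (at y))
      = (\<rho> powr c * cmod ((1 / (4 * z)) powr of_real \<nu>)) / (2 * s\<^sup>2) * cmod (bessel_kernel_deriv \<nu> z y \<rho>)"
      unfolding vector_derivative_p_Bn[OF y \<rho> z(1)] \<nu>_def[symmetric]
      by (simp add: norm_mult norm_divide s(2))
    also have "\<dots> \<le> (\<rho> powr c * cmod ((1 / (4 * z)) powr of_real \<nu>)) / (2 * s\<^sup>2) * (C * P powr (- (c / 2)) * G / (2 * s) * X)"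
      by (intro mult_left_mono bk) simp
    also have "\<dots> = L * inverse (s\<^sup>2) * (R powr c * P powr (- (c / 2)) * X) * G"
      unfolding pre L_def using s by (simp add: field_simps power2_eq_square)
    also have "\<dots> \<le> L * inverse (s\<^sup>2) * (2 * (2 + 2 * d) powr (\<bar>c\<bar> + 2) * min Y 1 * min R 1 powr c) * G"
      using neumann_weight_bound[OF YR(1,2), of X c] L
      by (intro mult_right_mono mult_left_mono) (auto simp: X_def P_def d_def G_def)
    also have "\<dots> = 2 * L * inverse (s\<^sup>2) * min Y 1 * min R 1 powr c * ((2 + 2 * d) powr (\<bar>c\<bar> + 2) * G)"
      by (simp only: mult_ac)
    also have "\<dots> \<le> 2 * L * inverse (s\<^sup>2) * min Y 1 * min R 1 powr c * (K * exp (- (\<sigma> * d\<^sup>2 / 8)))"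
      unfolding G_def using L YR by (intro mult_left_mono K) (auto simp: d_def)
    also have "\<sigma> * d\<^sup>2 / 8 = \<bar>y - \<rho>\<bar>\<^sup>2 / (8 / \<sigma> * cmod z)"
      using s \<sigma> unfolding d_def s(2) Y_def R_def by (simp add: power_divide mult_ac flip: diff_divide_distrib)
    finally show "cmod (vector_derivative (\<lambda>t. p_Bn c z t \<rho>) (at y))
        \<le> 2 * L * K * inverse (cmod z) * min (y / sqrt (cmod z)) 1
            * (min (\<rho> / sqrt (cmod z)) 1) powr c
            * exp (- (\<bar>y - \<rho>\<bar>\<^sup>2 / (8 / \<sigma> * cmod z)))"
      unfolding s_def[symmetric] Y_def[symmetric] R_def[symmetric] unfolding s(2) by (simp only: mult_ac)
  qed
qed

text \<open>Compared with the other kernel, the factor \<open>y powr (1 - c)\<close> adds a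
  product-rule term with a coefficient of size \<open>k\<close>;
  \<open>dirichlet_weight_bound\<close> treats both terms at once.\<close>

lemma p_Bd_deriv_bound:
  assumes \<sigma>: "\<sigma> > 0" "\<sigma> \<le> 1"
  shows "\<exists>C > 0. \<forall>z y \<rho>. z \<noteq> 0 \<longrightarrow> \<sigma> * cmod z \<le> Re z \<longrightarrow> y > 0 \<longrightarrow> \<rho> > 0 \<longrightarrow>
      cmod (vector_derivative (\<lambda>t. p_Bd c z t \<rho>) (at y))
        \<le> C * inverse (cmod z) * (min (y / sqrt (cmod z)) 1) powr (- c)
            * min (\<rho> / sqrt (cmod z)) 1
            * exp (- (\<bar>y - \<rho>\<bar>\<^sup>2 / (8 / \<sigma> * cmod z)))"
proof -
  define \<nu> where "\<nu> = (1 - c) / 2"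
  obtain C1 C2 where "bessel_bound \<sigma> \<nu> C1" "bessel_bound \<sigma> (\<nu> + 1) C2"
    using bessel_bound_exists[OF \<sigma>] by meson
  then obtain C where C: "bessel_bound \<sigma> \<nu> C" "bessel_bound \<sigma> (\<nu> + 1) C"
    by (meson bessel_bound_mono max.cobounded1 max.cobounded2)
  then have C0: "C > 0" by (simp add: bessel_bound_def)
  obtain K where K: "K > 0" "\<And>d. d \<ge> 0 \<Longrightarrow> (2 + 2 * d) powr (\<bar>c\<bar> + 3) * exp (- (\<sigma> * d\<^sup>2 / 4)) \<le> K * exp (- (\<sigma> * d\<^sup>2 / 8))"
    using powr_gaussian_bound[OF \<sigma>(1), of "\<bar>c\<bar> + 3"] by auto
  define k where "k = \<bar>1 - c\<bar>"
  have k: "k \<ge> 0" by (simp add: k_def)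
  define L where "L = 4 powr (- \<nu>) / 2 * C"
  have L: "L > 0" using C0 by (simp add: L_def)
  show ?thesis
  proof (intro exI[of _ "(k + 1) * L * K"] conjI allI impI)
    show "(k + 1) * L * K > 0" using L K k by simp
    fix z :: complex and y \<rho> :: real
    assume z: "z \<noteq> 0" "\<sigma> * cmod z \<le> Re z" and y: "y > 0" and \<rho>: "\<rho> > 0"
    define s where "s = sqrt (cmod z)"
    define Y where "Y = y / s"
    define R where "R = \<rho> / s"
    have s: "s > 0" "cmod z = s\<^sup>2" using z by (auto simp: s_def)
    have YR: "Y > 0" "R > 0" "y = s * Y" "\<rho> = s * R" using s y \<rho> by (auto simp: Y_def R_def)
    define P where "P = 1 + Y * R / 2"
    define d where "d = \<bar>Y - R\<bar>"
    define G where "G = exp (- (\<sigma> * d\<^sup>2 / 4))"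
    define N where "N = k + Y * (d + R / P) / 2"
    have P: "P \<ge> 1" using YR by (simp add: P_def)
    have e: "- \<nu> - 1 / 2 = c / 2 - 1" by (simp add: \<nu>_def field_simps)
    note kb = bessel_kernel_bounds[OF \<sigma>(1) z YR(1,2) C, folded s_def, folded YR(3,4),
      folded P_def, folded d_def, folded G_def, unfolded e]
    \<comment> \<open>The second entry of the minimum suffices: the weight in \<open>y\<close> comes
      from the factor \<open>y powr (- c)\<close>.\<close>
    have "cmod (bessel_kernel_deriv \<nu> z y \<rho>) \<le> C * P powr (c / 2 - 1) * G / (2 * s) * (d + R / P)"
      by (rule order.trans[OF kb(2)], intro mult_left_mono) (use C0 s in \<open>auto simp: G_def\<close>)
    then have "y * cmod (bessel_kernel_deriv \<nu> z y \<rho>) \<le> y * (C * P powr (c / 2 - 1) * G / (2 * s) * (d + R / P))"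
      using y by (intro mult_left_mono) auto
    also have "\<dots> = C * P powr (c / 2 - 1) * G * (Y * (d + R / P) / 2)"
      using s by (simp add: Y_def mult_ac)
    finally have bk: "y * cmod (bessel_kernel_deriv \<nu> z y \<rho>) + k * cmod (bessel_kernel \<nu> z y \<rho>)
        \<le> C * P powr (c / 2 - 1) * G * N"
      using mult_left_mono[OF kb(1) k] unfolding N_def distrib_left[of _ k] by (simp only: mult_ac)
    \<comment> \<open>Here \<open>1 - c - 2 * \<nu> = 0\<close>, so the powers of \<open>s\<close>
      cancel completely.\<close>
    have pre: "\<rho> * y powr (- c) * cmod ((1 / (4 * z)) powr of_real \<nu>) = 4 powr (- \<nu>) * (R * Y powr (- c))"
    proof -
      have "1 + - c + - 2 * \<nu> = 0" by (simp add: \<nu>_def field_simps)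
      then have "s powr 1 * s powr (- c) * s powr (- 2 * \<nu>) = s powr 0" by (simp only: flip: powr_add)
      then have "s * (s powr (- c) * s powr (- 2 * \<nu>)) = 1" using s by simp
      moreover have "\<rho> * y powr (- c) * cmod ((1 / (4 * z)) powr of_real \<nu>)
          = 4 powr (- \<nu>) * (R * Y powr (- c)) * (s * (s powr (- c) * s powr (- 2 * \<nu>)))"
        unfolding norm_prefactor[OF z(1)] s_def[symmetric] YR(3,4) powr_mult by (simp only: mult_ac)
      ultimately show ?thesis by simp
    qed
    have y1: "y powr (1 - c) = y powr (- c) * y" using y by (simp add: powr_diff powr_minus_divide)
    have "cmod (vector_derivative (\<lambda>t. p_Bd c z t \<rho>) (at y))
      = \<rho> * cmod ((1 / (4 * z)) powr of_real \<nu>) / (2 * s\<^sup>2) *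
        cmod (of_real (y powr (1 - c)) * bessel_kernel_deriv \<nu> z y \<rho>
         + of_real ((1 - c) * y powr (- c)) * bessel_kernel \<nu> z y \<rho>)"
      unfolding vector_derivative_p_Bd[OF y \<rho> z(1)] \<nu>_def[symmetric] norm_mult norm_divide
      using \<rho> by (simp add: s(2))
    also have "\<dots> \<le> \<rho> * cmod ((1 / (4 * z)) powr of_real \<nu>) / (2 * s\<^sup>2) *
        (y powr (- c) * (y * cmod (bessel_kernel_deriv \<nu> z y \<rho>) + k * cmod (bessel_kernel \<nu> z y \<rho>)))"
    proof (intro mult_left_mono)
      show "cmod (of_real (y powr (1 - c)) * bessel_kernel_deriv \<nu> z y \<rho>
         + of_real ((1 - c) * y powr (- c)) * bessel_kernel \<nu> z y \<rho>)
         \<le> y powr (- c) * (y * cmod (bessel_kernel_deriv \<nu> z y \<rho>) + k * cmod (bessel_kernel \<nu> z y \<rho>))"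
      proof (rule norm_triangle_le)
        have "cmod (of_real (y powr (1 - c)) * bessel_kernel_deriv \<nu> z y \<rho>)
            = y powr (- c) * (y * cmod (bessel_kernel_deriv \<nu> z y \<rho>))"
          unfolding norm_mult norm_of_real y1 using y by (simp add: abs_mult)
        moreover have "cmod (of_real ((1 - c) * y powr (- c)) * bessel_kernel \<nu> z y \<rho>)
            = y powr (- c) * (k * cmod (bessel_kernel \<nu> z y \<rho>))"
          unfolding norm_mult norm_of_real abs_mult k_def by simp
        ultimately show "cmod (of_real (y powr (1 - c)) * bessel_kernel_deriv \<nu> z y \<rho>)
          + cmod (of_real ((1 - c) * y powr (- c)) * bessel_kernel \<nu> z y \<rho>)
          \<le> y powr (- c) * (y * cmod (bessel_kernel_deriv \<nu> z y \<rho>) + k * cmod (bessel_kernel \<nu> z y \<rho>))"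
          by (simp only: distrib_left)
      qed
    qed (use \<rho> in simp)
    also have "\<dots> \<le> \<rho> * cmod ((1 / (4 * z)) powr of_real \<nu>) / (2 * s\<^sup>2) *
        (y powr (- c) * (C * P powr (c / 2 - 1) * G * N))"
      using \<rho> by (intro mult_left_mono bk) auto
    also have "\<dots> = (\<rho> * y powr (- c) * cmod ((1 / (4 * z)) powr of_real \<nu>)) * (C * P powr (c / 2 - 1) * G * N) / (2 * s\<^sup>2)"
      by simp
    also have "\<dots> = L * inverse (s\<^sup>2) * (R * Y powr (- c) * P powr (c / 2 - 1) * N) * G"
      unfolding pre L_def using s by (simp add: field_simps)
    also have "\<dots> \<le> L * inverse (s\<^sup>2) * ((k + 1) * (2 + 2 * d) powr (\<bar>c\<bar> + 3) * min Y 1 powr (- c) * min R 1) * G"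
      using dirichlet_weight_bound[OF YR(1,2) k, of c] L
      by (intro mult_right_mono mult_left_mono) (auto simp: N_def P_def d_def G_def)
    also have "\<dots> = (k + 1) * L * inverse (s\<^sup>2) * min Y 1 powr (- c) * min R 1 * ((2 + 2 * d) powr (\<bar>c\<bar> + 3) * G)"
      by (simp only: mult_ac)
    also have "\<dots> \<le> (k + 1) * L * inverse (s\<^sup>2) * min Y 1 powr (- c) * min R 1 * (K * exp (- (\<sigma> * d\<^sup>2 / 8)))"
      unfolding G_def using L YR k by (intro mult_left_mono K) (auto simp: d_def)
    also have "\<sigma> * d\<^sup>2 / 8 = \<bar>y - \<rho>\<bar>\<^sup>2 / (8 / \<sigma> * cmod z)"
      using s \<sigma> unfolding d_def s(2) Y_def R_def by (simp add: power_divide mult_ac flip: diff_divide_distrib)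
    finally show "cmod (vector_derivative (\<lambda>t. p_Bd c z t \<rho>) (at y))
        \<le> (k + 1) * L * K * inverse (cmod z) * (min (y / sqrt (cmod z)) 1) powr (- c)
            * min (\<rho> / sqrt (cmod z)) 1
            * exp (- (\<bar>y - \<rho>\<bar>\<^sup>2 / (8 / \<sigma> * cmod z)))"
      unfolding s_def[symmetric] Y_def[symmetric] R_def[symmetric] unfolding s(2) by (simp only: mult_ac)
  qed
qed

section \<open>From the sector to uniform constants\<close>

text \<open>\<open>Re z = cmod z * cos (Arg z)\<close>, and the cosine decreases on
  \<open>[0, pi]\<close>, with \<open>cos (pi/2 - \<epsilon>) = sin \<epsilon>\<close>.\<close>

lemma sector_Re_ge:
  assumes "z \<in> sector (pi / 2 - \<epsilon>)" "\<epsilon> > 0"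
  shows "sin \<epsilon> * cmod z \<le> Re z"
proof -
  have z: "z \<noteq> 0" "\<bar>Arg z\<bar> < pi / 2 - \<epsilon>" using assms by (auto simp: sector_def)
  have "sin \<epsilon> = cos (pi / 2 - \<epsilon>)" by (simp add: cos_diff)
  also have "\<dots> \<le> cos \<bar>Arg z\<bar>"
    using z(2) assms(2) pi_gt_zero by (intro cos_monotone_0_pi_le) auto
  also have "\<dots> = cos (Arg z)" by (simp add: abs_if)
  also have "\<dots> = Re z / cmod z" using cos_Arg[OF z(1)] .
  finally show ?thesis using z(1) by (simp add: field_simps)
qed

theorem proposition2p9:
  fixes c \<epsilon> :: real
  assumes "0 < \<epsilon>" and "\<epsilon> < pi / 2"
  shows "\<exists>C > 0. \<exists>\<kappa> > 0. \<forall>z \<in> sector (pi / 2 - \<epsilon>). \<forall>y > 0. \<forall>\<rho> > 0.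
    (c < 1 \<longrightarrow>
      cmod (vector_derivative (\<lambda>t. p_Bd c z t \<rho>) (at y))
        \<le> C * inverse (cmod z) * (min (y / sqrt (cmod z)) 1) powr (- c)
            * min (\<rho> / sqrt (cmod z)) 1
            * exp (- (\<bar>y - \<rho>\<bar>\<^sup>2 / (\<kappa> * cmod z)))) \<and>
    (c > - 1 \<longrightarrow>
      cmod (vector_derivative (\<lambda>t. p_Bn c z t \<rho>) (at y))
        \<le> C * inverse (cmod z) * min (y / sqrt (cmod z)) 1
            * (min (\<rho> / sqrt (cmod z)) 1) powr c
            * exp (- (\<bar>y - \<rho>\<bar>\<^sup>2 / (\<kappa> * cmod z))))"
proof -
  define \<sigma> where "\<sigma> = sin \<epsilon>"
  have \<sigma>: "\<sigma> > 0" "\<sigma> \<le> 1" using assms by (auto simp: \<sigma>_def intro!: sin_gt_zero)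
  obtain Cd where Cd: "Cd > 0" "\<And>z y \<rho>. \<lbrakk>z \<noteq> 0; \<sigma> * cmod z \<le> Re z; y > 0; \<rho> > 0\<rbrakk> \<Longrightarrow>
      cmod (vector_derivative (\<lambda>t. p_Bd c z t \<rho>) (at y))
        \<le> Cd * inverse (cmod z) * (min (y / sqrt (cmod z)) 1) powr (- c)
            * min (\<rho> / sqrt (cmod z)) 1
            * exp (- (\<bar>y - \<rho>\<bar>\<^sup>2 / (8 / \<sigma> * cmod z)))"
    using p_Bd_deriv_bound[OF \<sigma>, of c] by blast
  obtain Cn where Cn: "Cn > 0" "\<And>z y \<rho>. \<lbrakk>z \<noteq> 0; \<sigma> * cmod z \<le> Re z; y > 0; \<rho> > 0\<rbrakk> \<Longrightarrow>
      cmod (vector_derivative (\<lambda>t. p_Bn c z t \<rho>) (at y))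
        \<le> Cn * inverse (cmod z) * min (y / sqrt (cmod z)) 1
            * (min (\<rho> / sqrt (cmod z)) 1) powr c
            * exp (- (\<bar>y - \<rho>\<bar>\<^sup>2 / (8 / \<sigma> * cmod z)))"
    using p_Bn_deriv_bound[OF \<sigma>, of c] by blast
  show ?thesis
  \<comment> \<open>Both kernels share the Gaussian constant \<open>8 / \<sigma>\<close>, so only
    the outer constants have to be merged.\<close>
  proof (rule exI[of _ "max Cd Cn"], intro conjI exI[of _ "8 / \<sigma>"] ballI allI impI)
    fix z y \<rho> assume "z \<in> sector (pi / 2 - \<epsilon>)" and y: "0 < (y::real)" "0 < (\<rho>::real)"
    then have z: "z \<noteq> 0" "\<sigma> * cmod z \<le> Re z"
      using sector_Re_ge[OF _ assms(1)] by (auto simp: \<sigma>_def sector_def)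
    show "cmod (vector_derivative (\<lambda>t. p_Bd c z t \<rho>) (at y))
        \<le> max Cd Cn * inverse (cmod z) * (min (y / sqrt (cmod z)) 1) powr (- c)
            * min (\<rho> / sqrt (cmod z)) 1
            * exp (- (\<bar>y - \<rho>\<bar>\<^sup>2 / (8 / \<sigma> * cmod z)))"
      by (rule order.trans[OF Cd(2)[OF z y]], intro mult_right_mono) (use y in auto)
    show "cmod (vector_derivative (\<lambda>t. p_Bn c z t \<rho>) (at y))
        \<le> max Cd Cn * inverse (cmod z) * min (y / sqrt (cmod z)) 1
            * (min (\<rho> / sqrt (cmod z)) 1) powr c
            * exp (- (\<bar>y - \<rho>\<bar>\<^sup>2 / (8 / \<sigma> * cmod z)))"
      by (rule order.trans[OF Cn(2)[OF z y]], intro mult_right_mono) (use y in auto)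
  qed (use Cd Cn \<sigma> in auto)
qed

end
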